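(* Let $k\in\mathbb{N}$, $r\in[k]$, $n\in\mathbb{N}$, $\lambda>0$, and consider the spiked model in dimension $k$ with $\sigma=1$. There is a constant $c>0$ (absolute) such that \[ \inf_{\widehat{\mathbf{V}}}\sup_{\boldsymbol{\Sigma}\in\Theta_0(k,k,r,\lambda)}\mathsf{E}\bigl\|\widehat{\mathbf{V}}\widehat{\mathbf{V}}'-\mathbf{V}\mathbf{V}'\bigr\|_{\mathrm F}^2\ \ge\ c\Bigl(r\wedge(k-r)\wedge\frac{r(k-r)}{nh(\lambda)}\Bigr). \]
   Context: Spiked model in dimension $k$: the $n\times k$ data matrix has i.i.d. rows $N(0,\boldsymbol{\Sigma})$ with $\boldsymbol{\Sigma}=\mathbf{V}\boldsymbol{\Lambda}\mathbf{V}'+\mathbf{I}_k$, $\mathbf{V}\in O(k,r)=\{\mathbf{V}\in\mathbb{R}^{k\times r}:\mathbf{V}'\mathbf{V}=\mathbf{I}_r\}$, $\boldsymbol{\Lambda}=\operatorname{diag}(\lambda_1,\dots,\lambda_r)$. Fix $\kappa>1$; $\Theta_0(k,k,r,\lambda)=\{\mathbf{V}\boldsymbol{\Lambda}\mathbf{V}'+\mathbf{I}_k: 0<\lambda\le\lambda_r\le\dots\le\lambda_1\le\kappa\lambda,\ \mathbf{V}\in O(k,r)\}$. $h(\lambda)=\lambda^2/(\lambda+1)$. The infimum is over all estimators with values in $O(k,r)$. *)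

theory Defs
  imports "HOL-Probability.Probability"
begin

(* Stiefel manifold O(k,r): k x r matrices with orthonormal columns (V'V = I_r);
   entries outside the index range are normalised to 0. *)
definition stiefel :: "nat \<Rightarrow> nat \<Rightarrow> (nat \<Rightarrow> nat \<Rightarrow> real) set" where
  "stiefel k r = {V. (\<forall>a<r. \<forall>b<r. (\<Sum>i<k. V i a * V i b) = (if a = b then 1 else 0))
                    \<and> (\<forall>i j. (k \<le> i \<or> r \<le> j) \<longrightarrow> V i j = 0)}"

definition proj :: "nat \<Rightarrow> nat \<Rightarrow> (nat \<Rightarrow> nat \<Rightarrow> real) \<Rightarrow> nat \<Rightarrow> nat \<Rightarrow> real" where
  "proj k r V = (\<lambda>i j. \<Sum>a<r. V i a * V j a)"

definition frob_loss :: "nat \<Rightarrow> nat \<Rightarrow> (nat \<Rightarrow> nat \<Rightarrow> real) \<Rightarrow> (nat \<Rightarrow> nat \<Rightarrow> real) \<Rightarrow> real" where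
  "frob_loss k r Vh V = (\<Sum>i<k. \<Sum>j<k. (proj k r Vh i j - proj k r V i j)^2)"

definition h :: "real \<Rightarrow> real" where
  "h lam = lam^2 / (lam + 1)"

(* Parameter set Theta_0(k,k,r,lambda): Sigma = V diag(l) V' + I_k with
   V in O(k,r), 0 < lambda <= l_{r-1} <= ... <= l_0 <= kappa*lambda (0-based). *)
definition Theta0 :: "real \<Rightarrow> nat \<Rightarrow> nat \<Rightarrow> real \<Rightarrow> ((nat \<Rightarrow> nat \<Rightarrow> real) \<times> (nat \<Rightarrow> real)) set" where
  "Theta0 \<kappa> k r lam = {(V, l). V \<in> stiefel k r \<and> 0 < lam
      \<and> (\<forall>a<r. lam \<le> l a \<and> l a \<le> \<kappa> * lam)
      \<and> (\<forall>a b. a \<le> b \<longrightarrow> b < r \<longrightarrow> l b \<le> l a)}"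

(* Symmetric square root of Sigma = V diag(l) V' + I:  A = V diag(sqrt(1+l)-1) V' + I,
   so that A A' = Sigma. *)
definition sqrt_Sigma :: "nat \<Rightarrow> (nat \<Rightarrow> nat \<Rightarrow> real) \<Rightarrow> (nat \<Rightarrow> real) \<Rightarrow> nat \<Rightarrow> nat \<Rightarrow> real" where
  "sqrt_Sigma r V l = (\<lambda>i j. (if i = j then 1 else 0) + (\<Sum>a<r. V i a * (sqrt (1 + l a) - 1) * V j a))"

definition noise_space :: "nat \<Rightarrow> nat \<Rightarrow> (nat \<times> nat \<Rightarrow> real) measure" where
  "noise_space n k = PiM ({..<n} \<times> {..<k}) (\<lambda>_. std_normal_distribution)"

definition data_space :: "nat \<Rightarrow> nat \<Rightarrow> (nat \<times> nat \<Rightarrow> real) measure" where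
  "data_space n k = PiM ({..<n} \<times> {..<k}) (\<lambda>_. lborel)"

(* Data matrix X = Z A' : rows x_i = A z_i are i.i.d. N(0, A A') = N(0, Sigma) *)
definition data :: "nat \<Rightarrow> nat \<Rightarrow> nat \<Rightarrow> (nat \<Rightarrow> nat \<Rightarrow> real) \<Rightarrow> (nat \<Rightarrow> real)
                    \<Rightarrow> (nat \<times> nat \<Rightarrow> real) \<Rightarrow> (nat \<times> nat \<Rightarrow> real)" where
  "data n k r V l Z = restrict (\<lambda>(i, j). \<Sum>m<k. sqrt_Sigma r V l j m * Z (i, m)) ({..<n} \<times> {..<k})"

definition estimators :: "nat \<Rightarrow> nat \<Rightarrow> nat \<Rightarrow> ((nat \<times> nat \<Rightarrow> real) \<Rightarrow> nat \<Rightarrow> nat \<Rightarrow> real) set" where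
  "estimators n k r = {Vh. (\<forall>X \<in> space (data_space n k). Vh X \<in> stiefel k r)
                        \<and> (\<forall>a b. (\<lambda>X. Vh X a b) \<in> borel_measurable (data_space n k))}"

definition risk :: "nat \<Rightarrow> nat \<Rightarrow> nat \<Rightarrow> ((nat \<times> nat \<Rightarrow> real) \<Rightarrow> nat \<Rightarrow> nat \<Rightarrow> real)
                    \<Rightarrow> (nat \<Rightarrow> nat \<Rightarrow> real) \<Rightarrow> (nat \<Rightarrow> real) \<Rightarrow> ennreal" where
  "risk n k r Vh V l = (\<integral>\<^sup>+ Z. ennreal (frob_loss k r (Vh (data n k r V l Z)) V) \<partial>noise_space n k)"

end

theory Submission
  imports Defs
begin

text \<open>Take all \<open>\<lambda>\<^sub>a = \<lambda>\<close>. The relative entropy between two such models is \<open>n h(\<lambda>) / 4\<close> times the squared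
  Frobenius distance of the projections. As a prior take the uniform distribution on finitely many
  frames with block form \<open>(I - (1 - c) U'U, s U)\<close>, where \<open>c\<^sup>2 + s\<^sup>2 = 1\<close>, the \<open>(k - r) \<times> r\<close> matrix \<open>U\<close>
  is a partial isometry of rank \<open>m\<close> about \<open>(r \<and> (k - r)) / 2\<close>, and \<open>s\<^sup>2\<close> is a small multiple of
  \<open>1 \<and> (r \<or> (k - r)) / (n h(\<lambda>))\<close>. The lower left block of the projection is \<open>s c U\<close>, so it suffices that
  no matrix is close to many of the \<open>U\<close>. They are built column by column from random signs in the
  orthogonal complement of the columns already chosen, of dimension
  \<open>d\<close> about \<open>(r \<or> (k - r)) / 2\<close>, and a ball of squared radius of order \<open>m\<close> then has prior mass at most \<open>(3/5) ^ (d m)\<close>.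
  The relative entropy to the frame with \<open>s = 0\<close> is a small multiple of \<open>d m\<close>, so changing the
  measure to that frame shows that every estimator misses with probability at least \<open>1/10\<close>.\<close>

section \<open>Linear changes of variables for product Gaussian measures\<close>

text \<open>By Fubini coordinate \<open>i\<close> is integrated innermost. With the other
  coordinates fixed, \<open>g_indep\<close> makes \<open>g x\<close> a constant, so the inner
  integral is a one-dimensional affine substitution.\<close>

lemma nn_integral_lborel_coordinate_affine:
  fixes f :: "('i \<Rightarrow> real) \<Rightarrow> ennreal" and a :: real
  assumes I: "finite I" "i \<in> I" and a: "0 < a"
    and f[measurable]: "f \<in> borel_measurable (PiM I (\<lambda>_. lborel))"
    and g[measurable]: "g \<in> borel_measurable (PiM I (\<lambda>_. lborel))"
    and g_indep: "\<And>x y. g (x(i := y)) = g x"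
  shows "(\<integral>\<^sup>+x. f (x(i := a * x i + g x)) \<partial>PiM I (\<lambda>_. lborel)) = ennreal (1 / a) * (\<integral>\<^sup>+x. f x \<partial>PiM I (\<lambda>_. lborel))"
proof -
  interpret product_sigma_finite "\<lambda>_::'i. lborel::real measure" by standard
  define J where "J = I - {i}"
  have IJ: "I = insert i J" "finite J" "i \<notin> J" using I by (auto simp: J_def)
  have [measurable]: "(\<lambda>x. x j) \<in> borel_measurable (PiM I (\<lambda>_. lborel))" if "j \<in> I" for j
    using measurable_component_singleton[OF that, of "\<lambda>_. lborel"] by simp
  have [measurable]: "(\<lambda>x. x(i := a * x i + g x)) \<in> measurable (PiM I (\<lambda>_. lborel)) (PiM I (\<lambda>_. lborel))"
    unfolding fun_upd_def
  proof (rule measurable_PiM_single')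
    show "(\<lambda>x. if j = i then a * x i + g x else x j) \<in> measurable (PiM I (\<lambda>_. lborel)) lborel" if "j \<in> I" for j
      using that I(2) by (cases "j = i") auto
  qed (use I in \<open>auto simp: space_PiM PiE_def extensional_def\<close>)
  have m2: "(\<lambda>x. f (x(i := a * x i + g x))) \<in> borel_measurable (PiM I (\<lambda>_. lborel))"
    by measurable
  have inner: "(\<integral>\<^sup>+y. f (x(i := y)) \<partial>lborel) = ennreal a * (\<integral>\<^sup>+y. f ((x(i := y))(i := a * (x(i := y)) i + g (x(i := y)))) \<partial>lborel)"
    if x: "x \<in> space (PiM J (\<lambda>_. lborel))" for x
  proof -
    have [measurable]: "(\<lambda>y. x(i := y)) \<in> measurable borel (PiM I (\<lambda>_. lborel))"
      using x IJ measurable_component_update[of x J "\<lambda>_. lborel" i] by (simp add: measurable_lborel1)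
    have "(\<integral>\<^sup>+y. f (x(i := y)) \<partial>lborel) = ennreal \<bar>a\<bar> * (\<integral>\<^sup>+y. f (x(i := g x + a * y)) \<partial>lborel)"
      by (rule nn_integral_real_affine) (use a in auto)
    then show ?thesis using a by (simp add: g_indep add.commute)
  qed
  have "(\<integral>\<^sup>+x. f x \<partial>PiM I (\<lambda>_. lborel)) = (\<integral>\<^sup>+x. \<integral>\<^sup>+y. f (x(i := y)) \<partial>lborel \<partial>PiM J (\<lambda>_. lborel))"
    unfolding IJ(1) by (rule product_nn_integral_insert) (use IJ f in auto)
  also have "\<dots> = (\<integral>\<^sup>+x. ennreal a * (\<integral>\<^sup>+y. f ((x(i := y))(i := a * (x(i := y)) i + g (x(i := y)))) \<partial>lborel) \<partial>PiM J (\<lambda>_. lborel))"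
    by (intro nn_integral_cong inner)
  also have "\<dots> = ennreal a * (\<integral>\<^sup>+x. \<integral>\<^sup>+y. f ((x(i := y))(i := a * (x(i := y)) i + g (x(i := y)))) \<partial>lborel \<partial>PiM J (\<lambda>_. lborel))"
  proof (rule nn_integral_cmult)
    have "(\<lambda>(x,y). f ((x(i := y))(i := a * (x(i := y)) i + g (x(i := y))))) \<in> borel_measurable (PiM J (\<lambda>_. lborel) \<Otimes>\<^sub>M lborel)"
    proof -
      have m1: "(\<lambda>(x,y). x(i := y)) \<in> measurable (PiM J (\<lambda>_. lborel) \<Otimes>\<^sub>M lborel) (PiM I (\<lambda>_. lborel))"
        unfolding IJ(1) by (rule measurable_add_dim)
      show ?thesis
        using measurable_compose[OF m1 m2] by (simp add: case_prod_unfold)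
    qed
    then show "(\<lambda>x. \<integral>\<^sup>+y. f ((x(i := y))(i := a * (x(i := y)) i + g (x(i := y)))) \<partial>lborel) \<in> borel_measurable (PiM J (\<lambda>_. lborel))"
      using lborel.borel_measurable_nn_integral by simp
  qed
  also have "(\<integral>\<^sup>+x. \<integral>\<^sup>+y. f ((x(i := y))(i := a * (x(i := y)) i + g (x(i := y)))) \<partial>lborel \<partial>PiM J (\<lambda>_. lborel))
      = (\<integral>\<^sup>+x. f (x(i := a * x i + g x)) \<partial>PiM I (\<lambda>_. lborel))"
    unfolding IJ(1) by (rule product_nn_integral_insert[symmetric]) (use IJ m2 in auto)
  finally have *: "(\<integral>\<^sup>+x. f x \<partial>PiM I (\<lambda>_. lborel)) = ennreal a * (\<integral>\<^sup>+x. f (x(i := a * x i + g x)) \<partial>PiM I (\<lambda>_. lborel))" .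
  show ?thesis
    unfolding * using a by (simp add: mult.assoc[symmetric] ennreal_mult[symmetric])
qed

definition dotp :: "'i set \<Rightarrow> ('i \<Rightarrow> real) \<Rightarrow> ('i \<Rightarrow> real) \<Rightarrow> real" where
  "dotp I v x = (\<Sum>i\<in>I. v i * x i)"

text \<open>For unit \<open>v\<close> this is I + (s - 1) v v': it scales the direction
  \<open>v\<close> by \<open>s\<close> and fixes the orthogonal complement. Restricting to
  \<open>I\<close> keeps the values in the space of the product measure.\<close>

definition stretch :: "'i set \<Rightarrow> real \<Rightarrow> ('i \<Rightarrow> real) \<Rightarrow> ('i \<Rightarrow> real) \<Rightarrow> 'i \<Rightarrow> real" where
  "stretch I s v x = (\<lambda>i\<in>I. x i + (s - 1) * v i * dotp I v x)"

lemma dotp_stretch: "dotp I w (stretch I s v x) = dotp I w x + (s - 1) * dotp I w v * dotp I v x"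
proof -
  have "dotp I w (stretch I s v x) = (\<Sum>i\<in>I. w i * x i + (s - 1) * dotp I v x * (w i * v i))"
    unfolding dotp_def[of I w] stretch_def by (intro sum.cong) (auto simp: algebra_simps)
  then show ?thesis
    by (simp add: sum.distrib dotp_def[of I w] flip: sum_distrib_left)
qed

lemma measurable_dotp[measurable]:
  assumes "\<And>i. i \<in> I \<Longrightarrow> sets (M i) = sets borel"
  shows "dotp I v \<in> borel_measurable (PiM I M)"
proof -
  have "(\<lambda>x. x i) \<in> borel_measurable (PiM I M)" if "i \<in> I" for i
    using measurable_component_singleton[OF that, of M] assms[OF that] measurable_cong_sets by blast
  then show ?thesis
    unfolding dotp_def[abs_def] by measurable
qed

lemma measurable_stretch:
  assumes "\<And>i. i \<in> I \<Longrightarrow> sets (M i) = sets borel"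
  shows "stretch I s v \<in> measurable (PiM I M) (PiM I M)"
proof -
  have [measurable]: "(\<lambda>x. x i) \<in> borel_measurable (PiM I M)" if "i \<in> I" for i
    using measurable_component_singleton[OF that, of M] assms[OF that] measurable_cong_sets by blast
  note measurable_dotp[OF assms, measurable]
  have "(\<lambda>x. x i + (s - 1) * v i * dotp I v x) \<in> measurable (PiM I M) (M i)" if "i \<in> I" for i
  proof -
    have "(\<lambda>x. x i + (s - 1) * v i * dotp I v x) \<in> borel_measurable (PiM I M)"
      using that by measurable
    then show ?thesis using assms[OF that] measurable_cong_sets by blast
  qed
  then show ?thesis
    unfolding stretch_def[abs_def] by (rule measurable_restrict)
qed

text \<open>The coordinates are replaced one at a time; after those in \<open>J\<close> have been replaced, the
  determinant is \<open>1 + (s - 1) |v\<^sub>J|\<^sup>2\<close>, which never vanishes.\<close>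
lemma nn_integral_lborel_partial_stretch:
  fixes f :: "('i \<Rightarrow> real) \<Rightarrow> ennreal" and s :: real
  assumes I: "finite I" and s: "0 < s" and v: "(\<Sum>i\<in>I. (v i)\<^sup>2) \<le> 1" and J: "J \<subseteq> I"
    and f: "f \<in> borel_measurable (PiM I (\<lambda>_. lborel))"
  shows "(\<integral>\<^sup>+x. f (\<lambda>i\<in>I. if i \<in> J then x i + (s - 1) * v i * dotp I v x else x i) \<partial>PiM I (\<lambda>_. lborel))
    = ennreal (1 / (1 + (s - 1) * (\<Sum>i\<in>J. (v i)\<^sup>2))) * (\<integral>\<^sup>+x. f x \<partial>PiM I (\<lambda>_. lborel))"
proof -
  have "finite J" using I J finite_subset by auto
  then show ?thesis using J f
  proof (induction J arbitrary: f rule: finite_induct)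
    case empty
    have "(\<integral>\<^sup>+x. f (restrict x I) \<partial>PiM I (\<lambda>_. lborel)) = (\<integral>\<^sup>+x. f x \<partial>PiM I (\<lambda>_. lborel))"
      by (intro nn_integral_cong) (simp add: space_PiM PiE_restrict)
    then show ?case by (simp add: restrict_def)
  next
    case (insert i J)
    have iI: "i \<in> I" and JI: "J \<subseteq> I" using insert by auto
    note [measurable] = insert.prems(2)
    define d where "d = 1 + (s - 1) * (\<Sum>i\<in>J. (v i)\<^sup>2)"
    define d' where "d' = 1 + (s - 1) * (\<Sum>i\<in>insert i J. (v i)\<^sup>2)"
    \<comment> \<open>Each of these determinants is a convex combination of 1 and
      \<open>s\<close>.\<close>
    have pos: "0 < 1 + (s - 1) * (\<Sum>i\<in>K. (v i)\<^sup>2)" if "K \<subseteq> I" for K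
    proof -
      have "(\<Sum>i\<in>K. (v i)\<^sup>2) \<le> (\<Sum>i\<in>I. (v i)\<^sup>2)" by (rule sum_mono2[OF I that]) auto
      then have q: "0 \<le> (\<Sum>i\<in>K. (v i)\<^sup>2)" "(\<Sum>i\<in>K. (v i)\<^sup>2) \<le> 1" using v by (auto intro: sum_nonneg)
      show ?thesis
      proof (cases "1 \<le> s")
        case True then show ?thesis using q by (simp add: add_pos_nonneg)
      next
        case False
        then have "(1 - s) * (\<Sum>i\<in>K. (v i)\<^sup>2) \<le> (1 - s) * 1" using q by (intro mult_left_mono) auto
        then show ?thesis using s by (simp add: algebra_simps)
      qed
    qed
    have d: "0 < d" "0 < d'" unfolding d_def d'_def using pos[OF JI] pos[OF insert.prems(1)] by auto
    have d': "d' = d + (s - 1) * (v i)\<^sup>2" using insert by (simp add: d_def d'_def algebra_simps)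
    \<comment> \<open>The update of coordinate \<open>i\<close> must use the original
      \<open>dotp I v x\<close>, although the coordinates in \<open>J\<close> are already changed.
      Replacing them multiplied that product by \<open>d\<close>, so it is recovered by dividing;
      collecting the terms in coordinate \<open>i\<close> gives the factor 1 + (s - 1) (v i)^2 / d =
      d' / d.\<close>
    define g where "g x = (s - 1) * v i / d * (\<Sum>j\<in>I - {i}. v j * x j)" for x
    define E where "E x = x(i := (d' / d) * x i + g x)" for x
    define T where "T x = (\<lambda>i\<in>I. if i \<in> J then x i + (s - 1) * v i * dotp I v x else x i)" for x
    define T' where "T' x = (\<lambda>j\<in>I. if j \<in> insert i J then x j + (s - 1) * v j * dotp I v x else x j)" for x
    have [measurable]: "(\<lambda>x. x j) \<in> borel_measurable (PiM I (\<lambda>_. lborel))" if "j \<in> I" for j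
      using measurable_component_singleton[OF that, of "\<lambda>_. lborel"] by simp
    have g[measurable]: "g \<in> borel_measurable (PiM I (\<lambda>_. lborel))"
      unfolding g_def[abs_def] by measurable
    have [measurable]: "E \<in> measurable (PiM I (\<lambda>_. lborel)) (PiM I (\<lambda>_. lborel))"
      unfolding E_def[abs_def] fun_upd_def
    proof (rule measurable_PiM_single')
      show "(\<lambda>x. if j = i then d' / d * x i + g x else x j) \<in> measurable (PiM I (\<lambda>_. lborel)) lborel" if "j \<in> I" for j
        using that by (cases "j = i") auto
    qed (use iI in \<open>auto simp: space_PiM PiE_def extensional_def\<close>)
    have ET: "E (T x) = T' x" for x
    proof
      fix j
      have "dotp I v (T x) = (\<Sum>j\<in>I. v j * x j + (if j \<in> J then (s - 1) * (v j)\<^sup>2 * dotp I v x else 0))"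
        unfolding dotp_def[of I v "T x"] by (intro sum.cong) (auto simp: T_def algebra_simps power2_eq_square)
      also have "\<dots> = dotp I v x + (\<Sum>j\<in>J. (s - 1) * (v j)\<^sup>2 * dotp I v x)"
        using I JI by (simp add: sum.distrib dotp_def sum.If_cases Int_absorb1)
      also have "\<dots> = d * dotp I v x" by (simp add: d_def algebra_simps sum_distrib_left sum_distrib_right)
      finally have dT: "dotp I v (T x) = d * dotp I v x" .
      have "(\<Sum>j\<in>I - {i}. v j * T x j) = dotp I v (T x) - v i * T x i"
        unfolding dotp_def using I iI by (simp add: sum_diff1)
      also have "T x i = x i" using insert iI by (simp add: T_def)
      finally have "g (T x) = (s - 1) * v i / d * (d * dotp I v x - v i * x i)" by (simp add: g_def dT)
      moreover have "T x i = x i" using insert iI by (simp add: T_def)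
      ultimately have "(d' / d) * T x i + g (T x) = x i + (s - 1) * v i * dotp I v x"
        using d unfolding d' by (simp add: field_simps power2_eq_square)
      then show "E (T x) j = T' x j"
        unfolding E_def T'_def using iI by (auto simp: T_def)
    qed
    have "(\<integral>\<^sup>+x. f (T' x) \<partial>PiM I (\<lambda>_. lborel)) = (\<integral>\<^sup>+x. f (E (T x)) \<partial>PiM I (\<lambda>_. lborel))"
      by (simp add: ET)
    also have "\<dots> = ennreal (1 / d) * (\<integral>\<^sup>+x. f (E x) \<partial>PiM I (\<lambda>_. lborel))"
      unfolding T_def d_def by (rule insert.IH[OF JI]) measurable
    also have "(\<integral>\<^sup>+x. f (E x) \<partial>PiM I (\<lambda>_. lborel)) = ennreal (1 / (d' / d)) * (\<integral>\<^sup>+x. f x \<partial>PiM I (\<lambda>_. lborel))"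
      unfolding E_def
    proof (rule nn_integral_lborel_coordinate_affine[OF I iI _ _ g])
      show "g (x(i := y)) = g x" for x y unfolding g_def by (auto intro!: sum.cong)
    qed (use d in auto)
    also have "ennreal (1 / d) * (ennreal (1 / (d' / d)) * (\<integral>\<^sup>+x. f x \<partial>PiM I (\<lambda>_. lborel))) = ennreal (1 / d') * (\<integral>\<^sup>+x. f x \<partial>PiM I (\<lambda>_. lborel))"
      using d by (simp add: mult.assoc[symmetric] ennreal_mult[symmetric])
    finally show ?case unfolding T'_def d'_def .
  qed
qed

lemma nn_integral_lborel_stretch:
  fixes f :: "('i \<Rightarrow> real) \<Rightarrow> ennreal"
  assumes "finite I" "0 < s" "(\<Sum>i\<in>I. (v i)\<^sup>2) = 1" "f \<in> borel_measurable (PiM I (\<lambda>_. lborel))"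
  shows "(\<integral>\<^sup>+x. f (stretch I s v x) \<partial>PiM I (\<lambda>_. lborel)) = ennreal (1 / s) * (\<integral>\<^sup>+x. f x \<partial>PiM I (\<lambda>_. lborel))"
  using nn_integral_lborel_partial_stretch[of I s v I f] assms
  by (simp add: stretch_def restrict_def cong: if_cong)

section \<open>Densities of stretched Gaussian vectors\<close>

lemma PiM_std_normal_eq_density:
  assumes I: "finite I"
  shows "PiM I (\<lambda>_. std_normal_distribution) = density (PiM I (\<lambda>_. lborel)) (\<lambda>x. ennreal (\<Prod>i\<in>I. std_normal_density (x i)))"
proof (rule sym)
  interpret N: product_prob_space "\<lambda>_::'a. std_normal_distribution" 
    by (intro product_prob_spaceI prob_space_normal_density) simp
  interpret product_sigma_finite "\<lambda>_::'a. lborel::real measure" by standard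
  show "density (PiM I (\<lambda>_. lborel)) (\<lambda>x. ennreal (\<Prod>i\<in>I. std_normal_density (x i))) = PiM I (\<lambda>_. std_normal_distribution)"
  proof (rule N.PiM_eqI[OF I])
    show "sets (density (PiM I (\<lambda>_. lborel)) (\<lambda>x. ennreal (\<Prod>i\<in>I. std_normal_density (x i)))) = sets (PiM I (\<lambda>_. std_normal_distribution))"
      by (auto intro!: sets_PiM_cong)
    fix A :: "'a \<Rightarrow> real set" assume "\<And>i. i \<in> I \<Longrightarrow> A i \<in> sets std_normal_distribution"
    then have A[measurable]: "\<And>i. i \<in> I \<Longrightarrow> A i \<in> sets borel" by simp
    have [measurable]: "(\<lambda>x. x j) \<in> borel_measurable (PiM I (\<lambda>_. lborel))" if "j \<in> I" for j
      using measurable_component_singleton[OF that, of "\<lambda>_. lborel"] by simp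
    have PA: "Pi\<^sub>E I A \<in> sets (PiM I (\<lambda>_. lborel))" using I by (intro sets_PiM_I_finite) auto
    have "emeasure (density (PiM I (\<lambda>_. lborel)) (\<lambda>x. ennreal (\<Prod>i\<in>I. std_normal_density (x i)))) (Pi\<^sub>E I A)
       = (\<integral>\<^sup>+x. ennreal (\<Prod>i\<in>I. std_normal_density (x i)) * indicator (Pi\<^sub>E I A) x \<partial>PiM I (\<lambda>_. lborel))"
      using PA by (subst emeasure_density) auto
    also have "\<dots> = (\<integral>\<^sup>+x. (\<Prod>i\<in>I. ennreal (std_normal_density (x i)) * indicator (A i) (x i)) \<partial>PiM I (\<lambda>_. lborel))"
    proof (rule nn_integral_cong)
      fix x assume "x \<in> space (PiM I (\<lambda>_. lborel :: real measure))"
      then have "x \<in> extensional I" by (auto simp: space_PiM PiE_def)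
      then have "(indicator (Pi\<^sub>E I A) x :: ennreal) = (\<Prod>i\<in>I. indicator (A i) (x i))"
        using I by (auto simp: indicator_def PiE_def Pi_iff)
      then show "ennreal (\<Prod>i\<in>I. std_normal_density (x i)) * indicator (Pi\<^sub>E I A) x = (\<Prod>i\<in>I. ennreal (std_normal_density (x i)) * indicator (A i) (x i))"
        by (simp add: prod.distrib prod_ennreal[symmetric])
    qed
    also have "\<dots> = (\<Prod>i\<in>I. \<integral>\<^sup>+x. ennreal (std_normal_density x) * indicator (A i) x \<partial>lborel)"
      by (rule product_nn_integral_prod[OF I]) auto
    also have "\<dots> = (\<Prod>i\<in>I. emeasure std_normal_distribution (A i))"
      by (intro prod.cong refl) (simp add: emeasure_density)
    finally show "emeasure (density (PiM I (\<lambda>_. lborel)) (\<lambda>x. ennreal (\<Prod>i\<in>I. std_normal_density (x i)))) (Pi\<^sub>E I A) = (\<Prod>i\<in>I. emeasure std_normal_distribution (A i))" .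
  qed
qed

lemma prod_std_normal_density:
  "finite I \<Longrightarrow> (\<Prod>i\<in>I. std_normal_density (x i)) = (1 / sqrt (2 * pi)) ^ card I * exp (- (\<Sum>i\<in>I. (x i)\<^sup>2) / 2)"
  unfolding std_normal_density_def
  by (subst prod.distrib) (simp add: exp_sum[symmetric] sum_negf sum_divide_distrib)

text \<open>The density of N(0, I + (s^2 - 1) v v') relative to N(0, I) for unit \<open>v\<close>:
  the covariance has determinant s^2 and inverse I - (1 - 1 / s^2) v v'.\<close>

definition stretch_density :: "'i set \<Rightarrow> real \<Rightarrow> ('i \<Rightarrow> real) \<Rightarrow> ('i \<Rightarrow> real) \<Rightarrow> real" where
  "stretch_density I s v x = (1 / s) * exp ((1 - 1 / s\<^sup>2) / 2 * (dotp I v x)\<^sup>2)"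

lemma nn_integral_std_normal_stretch:
  fixes f :: "('i \<Rightarrow> real) \<Rightarrow> ennreal"
  assumes I: "finite I" and s: "0 < s" and v: "(\<Sum>i\<in>I. (v i)\<^sup>2) = 1"
    and f: "f \<in> borel_measurable (PiM I (\<lambda>_. std_normal_distribution))"
  shows "(\<integral>\<^sup>+x. f (stretch I s v x) \<partial>PiM I (\<lambda>_. std_normal_distribution))
    = (\<integral>\<^sup>+x. f x * ennreal (stretch_density I s v x) \<partial>PiM I (\<lambda>_. std_normal_distribution))"
proof -
  have f'[measurable]: "f \<in> borel_measurable (PiM I (\<lambda>_. lborel))"
    using f measurable_cong_sets[OF sets_PiM_cong[OF refl, of I "\<lambda>_. std_normal_distribution" "\<lambda>_. lborel"] refl] by simp
  have S[measurable]: "stretch I s' v \<in> measurable (PiM I (\<lambda>_. lborel)) (PiM I (\<lambda>_. lborel))" for s'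
    by (rule measurable_stretch) simp
  have D[measurable]: "dotp I v \<in> borel_measurable (PiM I (\<lambda>_. lborel))"
    by (rule measurable_dotp) simp
  have [measurable]: "(\<lambda>x. x j) \<in> borel_measurable (PiM I (\<lambda>_. lborel))" if "j \<in> I" for j
    using measurable_component_singleton[OF that, of "\<lambda>_. lborel"] by simp
  define \<phi> where "\<phi> x = (\<Prod>i\<in>I. std_normal_density (x i))" for x
  have [measurable]: "\<phi> \<in> borel_measurable (PiM I (\<lambda>_. lborel))" unfolding \<phi>_def[abs_def] by measurable
  have \<phi>0: "0 \<le> \<phi> x" for x unfolding \<phi>_def by (simp add: prod_nonneg)
  define c where "c = (1 - 1 / s\<^sup>2) / 2"
  have vv: "dotp I v v = 1" using v by (simp add: dotp_def power2_eq_square)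
  \<comment> \<open>The Gaussian weight at \<open>x\<close> has to be written as a function of the
    stretched point before substituting. Stretching adds (s^2 - 1) (v . x)^2 to the squared length
    and multiplies v . x by \<open>s\<close>.\<close>
  have \<phi>S: "\<phi> x = \<phi> (stretch I s v x) * exp (c * (dotp I v (stretch I s v x))\<^sup>2)" for x
  proof -
    have "(\<Sum>i\<in>I. (stretch I s v x i)\<^sup>2) = (\<Sum>i\<in>I. (x i)\<^sup>2 + 2 * (s - 1) * dotp I v x * (v i * x i) + (s - 1)\<^sup>2 * (dotp I v x)\<^sup>2 * (v i)\<^sup>2)"
      unfolding stretch_def by (intro sum.cong) (auto simp: power2_eq_square algebra_simps)
    also have "\<dots> = (\<Sum>i\<in>I. (x i)\<^sup>2) + 2 * (s - 1) * dotp I v x * dotp I v x + (s - 1)\<^sup>2 * (dotp I v x)\<^sup>2 * (\<Sum>i\<in>I. (v i)\<^sup>2)"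
      by (simp add: sum.distrib sum_distrib_left dotp_def)
    also have "\<dots> = (\<Sum>i\<in>I. (x i)\<^sup>2) + (s\<^sup>2 - 1) * (dotp I v x)\<^sup>2"
      unfolding v by (simp add: power2_eq_square algebra_simps)
    finally have e1: "(\<Sum>i\<in>I. (stretch I s v x i)\<^sup>2) = (\<Sum>i\<in>I. (x i)\<^sup>2) + (s\<^sup>2 - 1) * (dotp I v x)\<^sup>2" .
    have "dotp I v (stretch I s v x) = s * dotp I v x"
      by (simp add: dotp_stretch vv algebra_simps)
    then have e2: "c * (dotp I v (stretch I s v x))\<^sup>2 = (s\<^sup>2 - 1) / 2 * (dotp I v x)\<^sup>2"
      using s by (simp add: c_def power_mult_distrib field_simps)
    have e3: "- (\<Sum>i\<in>I. (x i)\<^sup>2) / 2 = - (\<Sum>i\<in>I. (stretch I s v x i)\<^sup>2) / 2 + c * (dotp I v (stretch I s v x))\<^sup>2"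
      unfolding e1 e2 by (simp add: field_simps)
    show ?thesis
      unfolding \<phi>_def prod_std_normal_density[OF I] e3 exp_add by simp
  qed
  have "(\<integral>\<^sup>+x. f (stretch I s v x) \<partial>PiM I (\<lambda>_. std_normal_distribution))
    = (\<integral>\<^sup>+x. ennreal (\<phi> x) * f (stretch I s v x) \<partial>PiM I (\<lambda>_. lborel))"
    unfolding PiM_std_normal_eq_density[OF I] \<phi>_def[symmetric]
    by (subst nn_integral_density) auto
  also have "\<dots> = (\<integral>\<^sup>+x. (\<lambda>y. ennreal (\<phi> y * exp (c * (dotp I v y)\<^sup>2)) * f y) (stretch I s v x) \<partial>PiM I (\<lambda>_. lborel))"
    by (subst \<phi>S) simp
  also have "\<dots> = ennreal (1 / s) * (\<integral>\<^sup>+y. ennreal (\<phi> y * exp (c * (dotp I v y)\<^sup>2)) * f y \<partial>PiM I (\<lambda>_. lborel))"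
    by (rule nn_integral_lborel_stretch[OF I s v]) measurable
  also have "\<dots> = (\<integral>\<^sup>+y. ennreal (1 / s) * (ennreal (\<phi> y * exp (c * (dotp I v y)\<^sup>2)) * f y) \<partial>PiM I (\<lambda>_. lborel))"
    by (rule nn_integral_cmult[symmetric]) measurable
  also have "\<dots> = (\<integral>\<^sup>+y. ennreal (\<phi> y) * (f y * ennreal (stretch_density I s v y)) \<partial>PiM I (\<lambda>_. lborel))"
  proof (rule nn_integral_cong)
    fix y
    have "ennreal (stretch_density I s v y) = ennreal (1 / s) * ennreal (exp (c * (dotp I v y)\<^sup>2))"
      unfolding stretch_density_def c_def[symmetric] using s by (intro ennreal_mult) auto
    then show "ennreal (1 / s) * (ennreal (\<phi> y * exp (c * (dotp I v y)\<^sup>2)) * f y) = ennreal (\<phi> y) * (f y * ennreal (stretch_density I s v y))"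
      by (simp add: ennreal_mult[OF \<phi>0] mult_ac)
  qed
  also have "\<dots> = (\<integral>\<^sup>+x. f x * ennreal (stretch_density I s v x) \<partial>PiM I (\<lambda>_. std_normal_distribution))"
    unfolding PiM_std_normal_eq_density[OF I] \<phi>_def[symmetric] stretch_density_def
    by (subst nn_integral_density) auto
  finally show ?thesis .
qed

text \<open>For an orthonormal system this is I + (s - 1) P with P the projection onto its
  span.\<close>

definition pstretch :: "'i set \<Rightarrow> real \<Rightarrow> 'b set \<Rightarrow> ('b \<Rightarrow> 'i \<Rightarrow> real) \<Rightarrow> ('i \<Rightarrow> real) \<Rightarrow> 'i \<Rightarrow> real" where
  "pstretch I s B v x = (\<lambda>i\<in>I. x i + (s - 1) * (\<Sum>b\<in>B. v b i * dotp I (v b) x))"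

lemma dotp_commute: "dotp I v w = dotp I w v"
  by (simp add: dotp_def mult.commute)

lemma dotp_pstretch:
  "dotp I w (pstretch I s B v x) = dotp I w x + (s - 1) * (\<Sum>b\<in>B. dotp I w (v b) * dotp I (v b) x)"
proof -
  have "dotp I w (pstretch I s B v x) = (\<Sum>i\<in>I. w i * x i + (s - 1) * (\<Sum>b\<in>B. w i * v b i * dotp I (v b) x))"
    unfolding dotp_def[of I w] pstretch_def
    by (intro sum.cong) (auto simp: algebra_simps sum_distrib_left)
  also have "\<dots> = dotp I w x + (s - 1) * (\<Sum>i\<in>I. \<Sum>b\<in>B. w i * v b i * dotp I (v b) x)"
    by (simp add: sum.distrib dotp_def[of I w] flip: sum_distrib_left)
  also have "(\<Sum>i\<in>I. \<Sum>b\<in>B. w i * v b i * dotp I (v b) x) = (\<Sum>b\<in>B. dotp I w (v b) * dotp I (v b) x)"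
    by (subst sum.swap) (simp add: dotp_def[of I w] sum_distrib_right)
  finally show ?thesis .
qed

text \<open>For orthonormal vectors the map is a composition of single stretches. The density
  collected so far depends only on inner products with vectors orthogonal to the next one, so the
  next stretch leaves it unchanged and the densities multiply.\<close>

lemma nn_integral_std_normal_pstretch:
  fixes f :: "('i \<Rightarrow> real) \<Rightarrow> ennreal"
  assumes I: "finite I" and s: "0 < s" and B: "finite B"
    and orth: "\<And>b c. b \<in> B \<Longrightarrow> c \<in> B \<Longrightarrow> dotp I (v b) (v c) = (if b = c then 1 else 0)"
    and f: "f \<in> borel_measurable (PiM I (\<lambda>_. std_normal_distribution))"
  shows "(\<integral>\<^sup>+x. f (pstretch I s B v x) \<partial>PiM I (\<lambda>_. std_normal_distribution))
    = (\<integral>\<^sup>+x. f x * ennreal ((1 / s) ^ card B * exp ((1 - 1 / s\<^sup>2) / 2 * (\<Sum>b\<in>B. (dotp I (v b) x)\<^sup>2)))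
        \<partial>PiM I (\<lambda>_. std_normal_distribution))"
  using B orth f
proof (induction B arbitrary: f rule: finite_induct)
  case empty
  have "(\<integral>\<^sup>+x. f (restrict x I) \<partial>PiM I (\<lambda>_. std_normal_distribution)) = (\<integral>\<^sup>+x. f x \<partial>PiM I (\<lambda>_. std_normal_distribution))"
    by (intro nn_integral_cong) (simp add: space_PiM PiE_restrict)
  then show ?case by (simp add: pstretch_def restrict_def)
next
  case (insert b B)
  let ?\<mu> = "PiM I (\<lambda>_. std_normal_distribution)"
  define c where "c = (1 - 1 / s\<^sup>2) / 2"
  define \<rho> where "\<rho> x = (1 / s) ^ card B * exp (c * (\<Sum>b\<in>B. (dotp I (v b) x)\<^sup>2))" for x
  have [measurable]: "f \<in> borel_measurable ?\<mu>" by fact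
  have [measurable]: "dotp I w \<in> borel_measurable ?\<mu>" for w
    by (rule measurable_dotp) simp
  have [measurable]: "stretch I s w \<in> measurable ?\<mu> ?\<mu>" for w
    by (rule measurable_stretch) simp
  have [measurable]: "\<rho> \<in> borel_measurable ?\<mu>"
    unfolding \<rho>_def[abs_def] by measurable
  have vb: "dotp I (v b) (v b) = 1" using insert.prems(1)[of b b] by simp
  have ob: "dotp I (v b') (v b) = 0" "dotp I (v b) (v b') = 0" if "b' \<in> B" for b'
    using that insert.prems(1)[of b' b] insert.prems(1)[of b b'] insert.hyps by auto
  have step: "pstretch I s (insert b B) v x = stretch I s (v b) (pstretch I s B v x)" for x
  proof -
    have "dotp I (v b) (pstretch I s B v x) = dotp I (v b) x"
      using ob by (simp add: dotp_pstretch)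
    then show ?thesis
      using insert.hyps by (intro ext) (auto simp: pstretch_def stretch_def restrict_def algebra_simps)
  qed
  have inv: "\<rho> (stretch I s (v b) x) = \<rho> x" for x
    unfolding \<rho>_def using ob by (simp add: dotp_stretch)
  have "(\<integral>\<^sup>+x. f (pstretch I s (insert b B) v x) \<partial>?\<mu>) = (\<integral>\<^sup>+x. f (stretch I s (v b) (pstretch I s B v x)) \<partial>?\<mu>)"
    by (simp only: step)
  also have "\<dots> = (\<integral>\<^sup>+x. f (stretch I s (v b) x) * ennreal (\<rho> x) \<partial>?\<mu>)"
    unfolding \<rho>_def c_def using insert.prems(1) by (intro insert.IH) (auto, measurable)
  also have "\<dots> = (\<integral>\<^sup>+x. (\<lambda>y. f y * ennreal (\<rho> y)) (stretch I s (v b) x) \<partial>?\<mu>)"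
    by (simp add: inv)
  also have "\<dots> = (\<integral>\<^sup>+x. f x * ennreal (\<rho> x) * ennreal (stretch_density I s (v b) x) \<partial>?\<mu>)"
    using vb by (intro nn_integral_std_normal_stretch[OF I s]) (auto simp: dotp_def power2_eq_square)
  also have "\<dots> = (\<integral>\<^sup>+x. f x * ennreal ((1 / s) ^ card (insert b B) * exp (c * (\<Sum>b\<in>insert b B. (dotp I (v b) x)\<^sup>2))) \<partial>?\<mu>)"
  proof (rule nn_integral_cong)
    fix x
    have "\<rho> x * stretch_density I s (v b) x = (1 / s) ^ card (insert b B) * exp (c * (\<Sum>b\<in>insert b B. (dotp I (v b) x)\<^sup>2))"
      unfolding \<rho>_def stretch_density_def c_def[symmetric] using insert.hyps
      by (simp add: distrib_left exp_add)
    moreover have "ennreal (\<rho> x * stretch_density I s (v b) x) = ennreal (\<rho> x) * ennreal (stretch_density I s (v b) x)"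
      using s by (intro ennreal_mult) (auto simp: \<rho>_def stretch_density_def)
    ultimately show "f x * ennreal (\<rho> x) * ennreal (stretch_density I s (v b) x)
       = f x * ennreal ((1 / s) ^ card (insert b B) * exp (c * (\<Sum>b\<in>insert b B. (dotp I (v b) x)\<^sup>2)))"
      by (simp add: mult.assoc)
  qed
  finally show ?case unfolding c_def .
qed

section \<open>Second moments of linear forms in Gaussian vectors\<close>

lemma std_normal_first_moment:
  "integrable std_normal_distribution (\<lambda>x. x)" "integral\<^sup>L std_normal_distribution (\<lambda>x. x) = 0"
  using std_normal_moment_odd[of 0]
  by (auto simp: integrable_density integral_density has_bochner_integral_iff)

lemma std_normal_second_moment:
  "integrable std_normal_distribution (\<lambda>x. x\<^sup>2)" "integral\<^sup>L std_normal_distribution (\<lambda>x. x\<^sup>2) = 1"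
  using std_normal_moment_even[of 1]
  by (auto simp: integrable_density integral_density has_bochner_integral_iff fact_2)

lemma std_normal_mixed_moment:
  fixes p q :: 'i
  assumes I: "finite I" "p \<in> I" "q \<in> I"
  shows "integrable (PiM I (\<lambda>_. std_normal_distribution)) (\<lambda>x. x p * x q)"
    "integral\<^sup>L (PiM I (\<lambda>_. std_normal_distribution)) (\<lambda>x. x p * x q) = (if p = q then 1 else 0)"
proof -
  interpret N: prob_space std_normal_distribution by (intro prob_space_normal_density) simp
  interpret P: product_prob_space "\<lambda>_::'i. std_normal_distribution" 
    by (intro product_prob_spaceI prob_space_normal_density) simp
  \<comment> \<open>The monomial becomes a product over all coordinates, with factors y^2, y or 1,
    so that the integral factors by independence.\<close>
  define f where "f i y = (if i = p then y else 1) * (if i = q then y else 1 :: real)" for i y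
  have prod: "(\<Prod>i\<in>I. f i (x i)) = x p * x q" for x
    unfolding f_def prod.distrib using I by (simp add: prod.delta)
  have int: "integrable std_normal_distribution (f i)" for i
    unfolding f_def[abs_def] using std_normal_first_moment std_normal_second_moment
    by (cases "i = p"; cases "i = q") (auto simp: power2_eq_square)
  show "integrable (PiM I (\<lambda>_. std_normal_distribution)) (\<lambda>x. x p * x q)"
    using P.product_integrable_prod[of I f, OF I(1) int] by (simp add: prod)
  have "integral\<^sup>L (PiM I (\<lambda>_. std_normal_distribution)) (\<lambda>x. x p * x q) = (\<Prod>i\<in>I. integral\<^sup>L std_normal_distribution (f i))"
    using P.product_integral_prod[of I f, OF I(1) int] by (simp add: prod)
  also have "\<dots> = (if p = q then 1 else 0)"
  proof (cases "p = q")
    case True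
    have "integral\<^sup>L std_normal_distribution (f i) = 1" for i
      unfolding f_def[abs_def] using std_normal_second_moment N.prob_space True
      by (cases "i = q") (auto simp: power2_eq_square)
    then show ?thesis using True by simp
  next
    case False
    then have "integral\<^sup>L std_normal_distribution (f p) = 0"
      unfolding f_def[abs_def] using std_normal_first_moment by simp
    then show ?thesis using False I by (auto intro!: prod_zero)
  qed
  finally show "integral\<^sup>L (PiM I (\<lambda>_. std_normal_distribution)) (\<lambda>x. x p * x q) = (if p = q then 1 else 0)" .
qed

lemma std_normal_dotp_square:
  assumes I: "finite I"
  shows "integrable (PiM I (\<lambda>_. std_normal_distribution)) (\<lambda>x. (dotp I w x)\<^sup>2)"
    "integral\<^sup>L (PiM I (\<lambda>_. std_normal_distribution)) (\<lambda>x. (dotp I w x)\<^sup>2) = (\<Sum>i\<in>I. (w i)\<^sup>2)"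
proof -
  have eq: "(dotp I w x)\<^sup>2 = (\<Sum>p\<in>I. \<Sum>q\<in>I. w p * w q * (x p * x q))" for x
    unfolding dotp_def power2_eq_square sum_product by (intro sum.cong) (auto simp: mult_ac)
  note m = std_normal_mixed_moment[OF I]
  show "integrable (PiM I (\<lambda>_. std_normal_distribution)) (\<lambda>x. (dotp I w x)\<^sup>2)"
    unfolding eq using m(1) by (intro Bochner_Integration.integrable_sum integrable_mult_right) auto
  have "integral\<^sup>L (PiM I (\<lambda>_. std_normal_distribution)) (\<lambda>x. (dotp I w x)\<^sup>2)
     = (\<Sum>p\<in>I. integral\<^sup>L (PiM I (\<lambda>_. std_normal_distribution)) (\<lambda>x. \<Sum>q\<in>I. w p * w q * (x p * x q)))"
    unfolding eq using m(1)
    by (intro Bochner_Integration.integral_sum Bochner_Integration.integrable_sum integrable_mult_right) auto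
  also have "\<dots> = (\<Sum>p\<in>I. \<Sum>q\<in>I. integral\<^sup>L (PiM I (\<lambda>_. std_normal_distribution)) (\<lambda>x. w p * w q * (x p * x q)))"
    using m(1) by (intro sum.cong refl Bochner_Integration.integral_sum integrable_mult_right) auto
  also have "\<dots> = (\<Sum>p\<in>I. \<Sum>q\<in>I. w p * w q * (if p = q then 1 else 0))"
    using m(2) by (intro sum.cong refl) simp
  also have "\<dots> = (\<Sum>p\<in>I. \<Sum>q\<in>I. if p = q then (w p)\<^sup>2 else 0)"
    by (intro sum.cong refl) (simp add: power2_eq_square)
  also have "\<dots> = (\<Sum>i\<in>I. (w i)\<^sup>2)"
    using I by simp
  finally show "integral\<^sup>L (PiM I (\<lambda>_. std_normal_distribution)) (\<lambda>x. (dotp I w x)\<^sup>2) = (\<Sum>i\<in>I. (w i)\<^sup>2)" .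
qed

section \<open>The spiked model as a stretched Gaussian vector\<close>

definition row_form :: "(nat \<Rightarrow> nat \<Rightarrow> real) \<Rightarrow> nat \<times> nat \<Rightarrow> nat \<times> nat \<Rightarrow> real" where
  "row_form V = (\<lambda>(i', a) (i, j). if i = i' then V j a else 0)"

text \<open>The squared Frobenius norm of X V, the statistic through which the likelihood depends on
  the frame.\<close>

definition energy :: "nat \<Rightarrow> nat \<Rightarrow> nat \<Rightarrow> (nat \<Rightarrow> nat \<Rightarrow> real) \<Rightarrow> (nat \<times> nat \<Rightarrow> real) \<Rightarrow> real" where
  "energy n k r V x = (\<Sum>b\<in>{..<n} \<times> {..<r}. (dotp ({..<n} \<times> {..<k}) (row_form V b) x)\<^sup>2)"

lemma dotp_row_form:
  "i < n \<Longrightarrow> dotp ({..<n} \<times> {..<k}) (row_form V (i, a)) x = (\<Sum>j<k. V j a * x (i, j))"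
proof -
  assume i: "i < n"
  have "dotp ({..<n} \<times> {..<k}) (row_form V (i, a)) x = (\<Sum>i'<n. \<Sum>j<k. if i' = i then V j a * x (i', j) else 0)"
    unfolding dotp_def row_form_def by (subst sum.cartesian_product) (auto intro!: sum.cong)
  also have "\<dots> = (\<Sum>i'<n. if i' = i then (\<Sum>j<k. V j a * x (i', j)) else 0)"
    by (intro sum.cong) auto
  also have "\<dots> = (\<Sum>j<k. V j a * x (i, j))"
    using i by simp
  finally show ?thesis .
qed

lemma dotp_row_form_row_form:
  assumes "i < n" "i' < n"
  shows "dotp ({..<n} \<times> {..<k}) (row_form V (i, a)) (row_form W (i', b)) = (if i = i' then \<Sum>j<k. V j a * W j b else 0)"
  unfolding dotp_row_form[OF assms(1)] by (auto simp: row_form_def)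

lemma row_form_orthonormal:
  assumes "V \<in> stiefel k r" "b \<in> {..<n} \<times> {..<r}" "c \<in> {..<n} \<times> {..<r}"
  shows "dotp ({..<n} \<times> {..<k}) (row_form V b) (row_form V c) = (if b = c then 1 else 0)"
  using assms by (cases b; cases c; cases "fst b = fst c") (auto simp: dotp_row_form_row_form stiefel_def)

text \<open>With equal spikes the square root of Sigma is I + (sqrt (1 + lam) - 1) V V', acting on
  each row. Placing each column of \<open>V\<close> in each row gives n r matrices, the row forms,
  and turns this into one map on vectors of length n k.\<close>

lemma data_eq_pstretch:
  "data n k r V (\<lambda>_. lam) Z = pstretch ({..<n} \<times> {..<k}) (sqrt (1 + lam)) ({..<n} \<times> {..<r}) (row_form V) Z"
proof
  fix p :: "nat \<times> nat"
  obtain i j where p: "p = (i, j)" by force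
  show "data n k r V (\<lambda>_. lam) Z p = pstretch ({..<n} \<times> {..<k}) (sqrt (1 + lam)) ({..<n} \<times> {..<r}) (row_form V) Z p"
  proof (cases "i < n \<and> j < k")
    case True
    let ?c = "sqrt (1 + lam) - 1"
    have "data n k r V (\<lambda>_. lam) Z p = (\<Sum>m<k. (if j = m then Z (i, m) else 0) + ?c * (\<Sum>a<r. V j a * (V m a * Z (i, m))))"
      unfolding data_def sqrt_Sigma_def p using True
      by (auto intro!: sum.cong simp: algebra_simps sum_distrib_left)
    also have "\<dots> = Z (i, j) + ?c * (\<Sum>a<r. V j a * (\<Sum>m<k. V m a * Z (i, m)))"
      using True by (simp add: sum.distrib flip: sum_distrib_left) (subst sum.swap, simp add: sum_distrib_left)
    \<comment> \<open>Row \<open>i\<close> sees only its own row forms; the vanishing terms of the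
      other rows are inserted to obtain a sum over all pairs.\<close>
    also have "(\<Sum>a<r. V j a * (\<Sum>m<k. V m a * Z (i, m))) = (\<Sum>i'<n. if i' = i then (\<Sum>a<r. V j a * (\<Sum>m<k. V m a * Z (i, m))) else 0)"
      using True by simp
    also have "\<dots> = (\<Sum>i'<n. \<Sum>a<r. row_form V (i', a) (i, j) * dotp ({..<n} \<times> {..<k}) (row_form V (i', a)) Z)"
    proof (intro sum.cong refl)
      fix i' assume "i' \<in> {..<n}"
      then show "(if i' = i then (\<Sum>a<r. V j a * (\<Sum>m<k. V m a * Z (i, m))) else 0)
          = (\<Sum>a<r. row_form V (i', a) (i, j) * dotp ({..<n} \<times> {..<k}) (row_form V (i', a)) Z)"
        by (simp add: dotp_row_form) (simp add: row_form_def)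
    qed
    also have "\<dots> = (\<Sum>b\<in>{..<n} \<times> {..<r}. row_form V b (i, j) * dotp ({..<n} \<times> {..<k}) (row_form V b) Z)"
      by (subst sum.cartesian_product) (auto intro!: sum.cong)
    finally show ?thesis using True by (simp add: p pstretch_def)
  next
    case False
    then show ?thesis by (auto simp: p data_def pstretch_def)
  qed
qed

lemma prob_space_noise_space: "prob_space (noise_space n k)"
  unfolding noise_space_def by (intro prob_space_PiM prob_space_normal_density) simp

lemma sets_noise_space: "sets (noise_space n k) = sets (data_space n k)"
  unfolding noise_space_def data_space_def by (rule sets_PiM_cong) auto

lemma measurable_energy: "energy n k r V \<in> borel_measurable (noise_space n k)"
proof -
  have [measurable]: "dotp ({..<n} \<times> {..<k}) w \<in> borel_measurable (noise_space n k)" for w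
    unfolding noise_space_def by (rule measurable_dotp) simp
  show ?thesis unfolding energy_def[abs_def] by measurable
qed

lemma measurable_data: "data n k r V l \<in> measurable (noise_space n k) (noise_space n k)"
  unfolding noise_space_def data_def
proof (rule measurable_restrict)
  fix p :: "nat \<times> nat" assume p: "p \<in> {..<n} \<times> {..<k}"
  have [measurable]: "(\<lambda>x. x q) \<in> borel_measurable (PiM ({..<n} \<times> {..<k}) (\<lambda>_. std_normal_distribution))" if "q \<in> {..<n} \<times> {..<k}" for q
    using measurable_component_singleton[OF that, of "\<lambda>_. std_normal_distribution"] by simp
  show "(\<lambda>Z. case p of (i, j) \<Rightarrow> \<Sum>m<k. sqrt_Sigma r V l j m * Z (i, m)) \<in> measurable (PiM ({..<n} \<times> {..<k}) (\<lambda>_. std_normal_distribution)) std_normal_distribution"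
    using p by (cases p) auto
qed

text \<open>The density of the data relative to pure noise, with 1 - 1 / s^2 = lam / (1 + lam) for
  s^2 = 1 + lam. Its prefactor does not depend on \<open>V\<close>, so it cancels in the likelihood
  ratio of two frames.\<close>

lemma nn_integral_data:
  assumes V: "V \<in> stiefel k r" and lam: "0 < lam" and f: "f \<in> borel_measurable (noise_space n k)"
  shows "(\<integral>\<^sup>+Z. f (data n k r V (\<lambda>_. lam) Z) \<partial>noise_space n k)
    = (\<integral>\<^sup>+x. f x * ennreal ((1 / sqrt (1 + lam)) ^ (n * r) * exp (lam / (2 * (1 + lam)) * energy n k r V x)) \<partial>noise_space n k)"
proof -
  have c: "(1 - 1 / (sqrt (1 + lam))\<^sup>2) / 2 = lam / (2 * (1 + lam))"
    using lam by (simp add: field_simps)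
  show ?thesis
    using nn_integral_std_normal_pstretch[of "{..<n} \<times> {..<k}" "sqrt (1 + lam)" "{..<n} \<times> {..<r}" "row_form V" f]
      row_form_orthonormal[OF V] f lam
    unfolding data_eq_pstretch noise_space_def[symmetric] energy_def[symmetric] c by simp
qed

text \<open>The relative entropy of the laws of the data under the spaces spanned by \<open>V\<close> and \<open>V\<^sub>0\<close>;
  it is \<open>n h(\<lambda>) / 4\<close> times the squared Frobenius distance of the projections.\<close>
definition spiked_KL :: "nat \<Rightarrow> nat \<Rightarrow> nat \<Rightarrow> real \<Rightarrow> (nat \<Rightarrow> nat \<Rightarrow> real) \<Rightarrow> (nat \<Rightarrow> nat \<Rightarrow> real) \<Rightarrow> real" where
  "spiked_KL n k r lam V V0 = real n * h lam / 2 * (real r - (\<Sum>a<r. \<Sum>b<r. (\<Sum>j<k. V j b * V0 j a)\<^sup>2))"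

text \<open>The map A taking noise to data is symmetric, so it can be moved onto the row forms of
  \<open>V0\<close>. The variance of each resulting linear form is |A v|^2 = v' Sigma v = 1 + lam
  |V' v|^2.\<close>

lemma energy_data_integral:
  assumes V: "V \<in> stiefel k r" and V0: "V0 \<in> stiefel k r" and lam: "0 < lam"
  shows "integrable (noise_space n k) (\<lambda>Z. energy n k r V0 (data n k r V (\<lambda>_. lam) Z))"
    and "integral\<^sup>L (noise_space n k) (\<lambda>Z. energy n k r V0 (data n k r V (\<lambda>_. lam) Z))
      = real n * (real r + lam * (\<Sum>a<r. \<Sum>b<r. (\<Sum>j<k. V j b * V0 j a)\<^sup>2))"
proof -
  let ?I = "{..<n} \<times> {..<k}" and ?B = "{..<n} \<times> {..<r}"
  define s where "s = sqrt (1 + lam)"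
  have s: "s\<^sup>2 = 1 + lam" using lam by (simp add: s_def)
  define w where "w c = pstretch ?I s ?B (row_form V) (row_form V0 c)" for c
  have E: "dotp ?I (row_form V0 c) (data n k r V (\<lambda>_. lam) Z) = dotp ?I (w c) Z" for c Z
    unfolding data_eq_pstretch s_def[symmetric] w_def
    by (subst (2) dotp_commute) (simp add: dotp_pstretch dotp_commute mult_ac)
  have norm: "(\<Sum>p\<in>?I. (w (i, a) p)\<^sup>2) = 1 + lam * (\<Sum>b<r. (\<Sum>j<k. V j b * V0 j a)\<^sup>2)" if c: "i < n" "a < r" for i a
  proof -
    let ?c = "(i, a)"
    \<comment> \<open>The squared length of the projection of this row form of \<open>V0\<close>
      onto the span of the row forms of \<open>V\<close>, the subspace that is stretched.\<close>
    define C where "C = (\<Sum>b\<in>?B. (dotp ?I (row_form V b) (row_form V0 ?c))\<^sup>2)"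
    have b: "dotp ?I (row_form V b) (w ?c) = s * dotp ?I (row_form V b) (row_form V0 ?c)" if "b \<in> ?B" for b
    proof -
      have "dotp ?I (row_form V b) (w ?c) = dotp ?I (row_form V b) (row_form V0 ?c)
        + (s - 1) * (\<Sum>b'\<in>?B. (if b = b' then 1 else 0) * dotp ?I (row_form V b') (row_form V0 ?c))"
        unfolding w_def dotp_pstretch using row_form_orthonormal[OF V that] by simp
      also have "(\<Sum>b'\<in>?B. (if b = b' then 1 else 0) * dotp ?I (row_form V b') (row_form V0 ?c)) = (\<Sum>b'\<in>?B. if b = b' then dotp ?I (row_form V b') (row_form V0 ?c) else 0)"
        by (intro sum.cong) auto
      also have "\<dots> = dotp ?I (row_form V b) (row_form V0 ?c)" using that by simp
      finally show ?thesis by (simp add: algebra_simps)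
    qed
    have "(\<Sum>p\<in>?I. (w ?c p)\<^sup>2) = dotp ?I (w ?c) (w ?c)" by (simp add: dotp_def power2_eq_square)
    also have "\<dots> = dotp ?I (w ?c) (row_form V0 ?c) + (s - 1) * (\<Sum>b\<in>?B. dotp ?I (w ?c) (row_form V b) * dotp ?I (row_form V b) (row_form V0 ?c))"
      by (subst (2) w_def) (rule dotp_pstretch)
    also have "(\<Sum>b\<in>?B. dotp ?I (w ?c) (row_form V b) * dotp ?I (row_form V b) (row_form V0 ?c)) = s * C"
      unfolding C_def sum_distrib_left
      by (intro sum.cong refl) (simp add: dotp_commute[of _ "w ?c"] b power2_eq_square)
    also have "dotp ?I (w ?c) (row_form V0 ?c) = 1 + (s - 1) * C"
    proof -
      have "dotp ?I (w ?c) (row_form V0 ?c) = dotp ?I (row_form V0 ?c) (row_form V0 ?c) + (s - 1) * (\<Sum>b\<in>?B. dotp ?I (row_form V0 ?c) (row_form V b) * dotp ?I (row_form V b) (row_form V0 ?c))"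
        by (subst dotp_commute, subst w_def) (rule dotp_pstretch)
      moreover have "(\<Sum>b\<in>?B. dotp ?I (row_form V0 ?c) (row_form V b) * dotp ?I (row_form V b) (row_form V0 ?c)) = C"
        unfolding C_def by (intro sum.cong refl) (simp add: dotp_commute[of _ "row_form V0 ?c"] power2_eq_square)
      moreover have "dotp ?I (row_form V0 ?c) (row_form V0 ?c) = 1"
        using row_form_orthonormal[OF V0, of ?c n ?c] c by simp
      ultimately show ?thesis by simp
    qed
    also have "1 + (s - 1) * C + (s - 1) * (s * C) = 1 + (s\<^sup>2 - 1) * C"
      by (simp add: power2_eq_square algebra_simps)
    also have "s\<^sup>2 - 1 = lam" by (simp add: s)
    also have "C = (\<Sum>i'<n. \<Sum>b<r. (dotp ?I (row_form V (i', b)) (row_form V0 ?c))\<^sup>2)"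
      unfolding C_def by (subst sum.cartesian_product) (auto intro!: sum.cong)
    also have "\<dots> = (\<Sum>i'<n. if i' = i then (\<Sum>b<r. (\<Sum>j<k. V j b * V0 j a)\<^sup>2) else 0)"
      using c by (intro sum.cong refl) (auto simp: dotp_row_form_row_form)
    also have "\<dots> = (\<Sum>b<r. (\<Sum>j<k. V j b * V0 j a)\<^sup>2)" using c by simp
    finally show ?thesis .
  qed
  have eq: "energy n k r V0 (data n k r V (\<lambda>_. lam) Z) = (\<Sum>c\<in>?B. (dotp ?I (w c) Z)\<^sup>2)" for Z
    unfolding energy_def E ..
  have m: "integrable (noise_space n k) (\<lambda>x. (dotp ?I u x)\<^sup>2)"
    "integral\<^sup>L (noise_space n k) (\<lambda>x. (dotp ?I u x)\<^sup>2) = (\<Sum>i\<in>?I. (u i)\<^sup>2)" for u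
    unfolding noise_space_def using std_normal_dotp_square[of ?I u] by auto
  show "integrable (noise_space n k) (\<lambda>Z. energy n k r V0 (data n k r V (\<lambda>_. lam) Z))"
    unfolding eq using m(1) by (intro Bochner_Integration.integrable_sum) auto
  have "integral\<^sup>L (noise_space n k) (\<lambda>Z. energy n k r V0 (data n k r V (\<lambda>_. lam) Z))
    = (\<Sum>c\<in>?B. integral\<^sup>L (noise_space n k) (\<lambda>Z. (dotp ?I (w c) Z)\<^sup>2))"
    unfolding eq using m(1) by (intro Bochner_Integration.integral_sum) auto
  also have "\<dots> = (\<Sum>c\<in>?B. \<Sum>p\<in>?I. (w c p)\<^sup>2)"
    by (simp only: m(2))
  also have "\<dots> = (\<Sum>i<n. \<Sum>a<r. \<Sum>p\<in>?I. (w (i, a) p)\<^sup>2)"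
    by (subst sum.cartesian_product) (auto intro!: sum.cong)
  also have "\<dots> = (\<Sum>i<n. \<Sum>a<r. 1 + lam * (\<Sum>b<r. (\<Sum>j<k. V j b * V0 j a)\<^sup>2))"
    using norm by (intro sum.cong refl) auto
  also have "\<dots> = real n * (real r + lam * (\<Sum>a<r. \<Sum>b<r. (\<Sum>j<k. V j b * V0 j a)\<^sup>2))"
    by (simp add: sum.distrib flip: sum_distrib_left)
  finally show "integral\<^sup>L (noise_space n k) (\<lambda>Z. energy n k r V0 (data n k r V (\<lambda>_. lam) Z))
      = real n * (real r + lam * (\<Sum>a<r. \<Sum>b<r. (\<Sum>j<k. V j b * V0 j a)\<^sup>2))" .
qed

section \<open>Change of measure between two frames\<close>

lemma exp_remainder_pos:
  fixes t :: real
  assumes "0 < t"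
  shows "0 < t - 1 + exp (- t)"
  using exp_minus_greater[of t] assms by linarith

lemma exp_remainder_mono:
  fixes t q :: real
  assumes t: "0 < t" and tq: "t \<le> q"
  shows "t - 1 + exp (- t) \<le> q - 1 + exp (- q)"
proof -
  \<comment> \<open>The drop exp (- t) - exp (- q) equals exp (- t) y, and hence is at most y \<le>
    q - t, the gain in the linear term.\<close>
  define y where "y = 1 - exp (t - q)"
  have "y \<le> q - t" using exp_ge_add_one_self[of "t - q"] unfolding y_def by linarith
  moreover have "0 \<le> y" using tq by (simp add: y_def)
  moreover have "exp (- t) * y \<le> 1 * y" using t \<open>0 \<le> y\<close> by (intro mult_right_mono) auto
  moreover have "exp (- t) * y = exp (- t) - exp (- q)"
    by (simp add: y_def right_diff_distrib flip: exp_add)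
  ultimately show ?thesis by linarith
qed

text \<open>With \<open>q\<close> the log-likelihood ratio of \<open>V\<close> against \<open>V\<^sub>0\<close>, the test is split according to
  \<open>q \<le> t\<close> or \<open>q > t\<close>; the second part is controlled by Markov's inequality for
  \<open>q - 1 + exp (- q) \<ge> 0\<close>, whose mean under \<open>V\<close> is exactly the relative entropy.\<close>
lemma nn_integral_data_change_measure:
  assumes V: "V \<in> stiefel k r" and V0: "V0 \<in> stiefel k r" and lam: "0 < lam" and t: "0 < t"
    and \<psi>: "\<psi> \<in> borel_measurable (noise_space n k)" and \<psi>0: "\<And>x. 0 \<le> \<psi> x" and \<psi>1: "\<And>x. \<psi> x \<le> (1::real)"
  shows "(\<integral>\<^sup>+Z. ennreal (\<psi> (data n k r V (\<lambda>_. lam) Z)) \<partial>noise_space n k)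
    \<le> ennreal (exp t) * (\<integral>\<^sup>+Z. ennreal (\<psi> (data n k r V0 (\<lambda>_. lam) Z)) \<partial>noise_space n k)
      + ennreal (spiked_KL n k r lam V V0 / (t - 1 + exp (- t)))"
proof -
  let ?\<mu> = "noise_space n k" and ?D = "\<lambda>V. data n k r V (\<lambda>_. lam)"
  interpret prob_space ?\<mu> by (rule prob_space_noise_space)
  note [measurable] = \<psi> measurable_energy[of n k r] measurable_data[of n k r]
  define c where "c = lam / (2 * (1 + lam))"
  define q where "q x = c * (energy n k r V x - energy n k r V0 x)" for x
  define g where "g = t - 1 + exp (- t)"
  define A where "A = (1 / sqrt (1 + lam)) ^ (n * r)"
  have A0: "0 \<le> A" using lam by (simp add: A_def)
  have g: "0 < g" unfolding g_def by (rule exp_remainder_pos[OF t])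
  have [measurable]: "q \<in> borel_measurable ?\<mu>" unfolding q_def[abs_def] by measurable
  \<comment> \<open>The factor exp (- q) is the density of the law under \<open>V0\<close> relative
    to the law under \<open>V\<close>.\<close>
  have transfer: "(\<integral>\<^sup>+Z. ennreal (\<phi> (?D V Z) * exp (- q (?D V Z))) \<partial>?\<mu>) = (\<integral>\<^sup>+Z. ennreal (\<phi> (?D V0 Z)) \<partial>?\<mu>)"
    if [measurable]: "\<phi> \<in> borel_measurable ?\<mu>" and \<phi>0: "\<And>x. 0 \<le> \<phi> x" for \<phi>
  proof -
    have "(\<integral>\<^sup>+Z. ennreal (\<phi> (?D V Z) * exp (- q (?D V Z))) \<partial>?\<mu>)
      = (\<integral>\<^sup>+x. ennreal (\<phi> x * exp (- q x)) * ennreal (A * exp (c * energy n k r V x)) \<partial>?\<mu>)"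
      unfolding A_def c_def by (rule nn_integral_data[OF V lam]) measurable
    also have "\<dots> = (\<integral>\<^sup>+x. ennreal (\<phi> x) * ennreal (A * exp (c * energy n k r V0 x)) \<partial>?\<mu>)"
    proof (rule nn_integral_cong)
      fix x
      have "exp (- q x) * exp (c * energy n k r V x) = exp (c * energy n k r V0 x)"
        unfolding q_def by (simp add: exp_add[symmetric] algebra_simps)
      moreover have "\<phi> x * exp (- q x) * (A * exp (c * energy n k r V x)) = \<phi> x * (A * (exp (- q x) * exp (c * energy n k r V x)))"
        by (simp only: mult_ac)
      moreover have "ennreal (\<phi> x * exp (- q x)) * ennreal (A * exp (c * energy n k r V x)) = ennreal (\<phi> x * exp (- q x) * (A * exp (c * energy n k r V x)))"
        using \<phi>0 A0 by (intro ennreal_mult[symmetric]) auto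
      moreover have "ennreal (\<phi> x) * ennreal (A * exp (c * energy n k r V0 x)) = ennreal (\<phi> x * (A * exp (c * energy n k r V0 x)))"
        using \<phi>0 A0 by (intro ennreal_mult[symmetric]) auto
      ultimately show "ennreal (\<phi> x * exp (- q x)) * ennreal (A * exp (c * energy n k r V x)) = ennreal (\<phi> x) * ennreal (A * exp (c * energy n k r V0 x))"
        by (simp only:)
    qed
    also have "\<dots> = (\<integral>\<^sup>+Z. ennreal (\<phi> (?D V0 Z)) \<partial>?\<mu>)"
      unfolding A_def c_def by (rule nn_integral_data[OF V0 lam, symmetric]) measurable
    finally show ?thesis .
  qed
  have pw: "\<psi> x \<le> exp t * (\<psi> x * exp (- q x)) + (q x - 1 + exp (- q x)) / g" for x
  proof (cases "q x \<le> t")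
    case True
    then have "1 \<le> exp t * exp (- q x)" by (simp flip: exp_add)
    then have "\<psi> x * 1 \<le> \<psi> x * (exp t * exp (- q x))" using \<psi>0 by (intro mult_left_mono) auto
    moreover have "0 \<le> (q x - 1 + exp (- q x)) / g" using g exp_ge_add_one_self[of "- q x"] by simp
    ultimately show ?thesis by (simp add: mult_ac)
  next
    case False
    then have "g \<le> q x - 1 + exp (- q x)" unfolding g_def using t by (intro exp_remainder_mono) auto
    then have "1 \<le> (q x - 1 + exp (- q x)) / g" using g by simp
    moreover have "0 \<le> exp t * (\<psi> x * exp (- q x))" using \<psi>0 by simp
    ultimately show ?thesis using \<psi>1[of x] by linarith
  qed
  \<comment> \<open>As a density, exp (- q) has mean one under \<open>V\<close>; so q - 1 + exp (-
    q) has the same mean as \<open>q\<close>.\<close>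
  have int_exp: "(\<integral>\<^sup>+Z. ennreal (exp (- q (?D V Z))) \<partial>?\<mu>) = 1"
    using transfer[of "\<lambda>_. 1"] emeasure_space_1 by simp
  then have i1: "integrable ?\<mu> (\<lambda>Z. exp (- q (?D V Z)))"
    by (intro integrableI_nonneg) auto
  have I1: "integral\<^sup>L ?\<mu> (\<lambda>Z. exp (- q (?D V Z))) = 1"
    using int_exp by (simp add: integral_eq_nn_integral)
  note eV = energy_data_integral[OF V V lam, of n] and eV0 = energy_data_integral[OF V V0 lam, of n]
  have i2: "integrable ?\<mu> (\<lambda>Z. q (?D V Z))"
    unfolding q_def using eV(1) eV0(1) by (intro integrable_mult_right Bochner_Integration.integrable_diff)
  have VV: "(\<Sum>a<r. \<Sum>b<r. (\<Sum>j<k. V j b * V j a)\<^sup>2) = real r"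
  proof -
    have "(\<Sum>a<r. \<Sum>b<r. (\<Sum>j<k. V j b * V j a)\<^sup>2) = (\<Sum>a<r. \<Sum>b<r. if b = a then 1 else 0)"
      using V by (intro sum.cong refl) (auto simp: stiefel_def)
    then show ?thesis by simp
  qed
  have I2: "integral\<^sup>L ?\<mu> (\<lambda>Z. q (?D V Z)) = spiked_KL n k r lam V V0"
  proof -
    \<comment> \<open>The terms n r cancel and c lam = h(lam) / 2.\<close>
    have "integral\<^sup>L ?\<mu> (\<lambda>Z. q (?D V Z)) = c * (real n * (real r + lam * real r) - real n * (real r + lam * (\<Sum>a<r. \<Sum>b<r. (\<Sum>j<k. V j b * V0 j a)\<^sup>2)))"
      unfolding q_def using eV eV0 by (simp add: VV Bochner_Integration.integral_diff)
    also have "\<dots> = spiked_KL n k r lam V V0"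
      unfolding spiked_KL_def c_def h_def using lam by (simp add: field_simps power2_eq_square)
    finally show ?thesis .
  qed
  have markov: "(\<integral>\<^sup>+Z. ennreal ((q (?D V Z) - 1 + exp (- q (?D V Z))) / g) \<partial>?\<mu>) = ennreal (spiked_KL n k r lam V V0 / g)"
  proof -
    have "(\<integral>\<^sup>+Z. ennreal ((q (?D V Z) - 1 + exp (- q (?D V Z))) / g) \<partial>?\<mu>) = ennreal (\<integral>Z. (q (?D V Z) - 1 + exp (- q (?D V Z))) / g \<partial>?\<mu>)"
    proof (rule nn_integral_eq_integral)
      show "AE Z in ?\<mu>. 0 \<le> (q (?D V Z) - 1 + exp (- q (?D V Z))) / g"
        using g exp_ge_add_one_self[of "- q (?D V _)"] by (intro AE_I2) (simp add: algebra_simps)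
    qed (use i1 i2 in simp)
    also have "(\<integral>Z. (q (?D V Z) - 1 + exp (- q (?D V Z))) / g \<partial>?\<mu>) = spiked_KL n k r lam V V0 / g"
      using i1 i2 I1 I2 prob_space by simp
    finally show ?thesis .
  qed
  have "(\<integral>\<^sup>+Z. ennreal (\<psi> (?D V Z)) \<partial>?\<mu>)
     \<le> (\<integral>\<^sup>+Z. ennreal (exp t) * ennreal (\<psi> (?D V Z) * exp (- q (?D V Z))) + ennreal ((q (?D V Z) - 1 + exp (- q (?D V Z))) / g) \<partial>?\<mu>)"
  proof (rule nn_integral_mono)
    fix Z
    let ?x = "?D V Z"
    have "0 \<le> (q ?x - 1 + exp (- q ?x)) / g" using g exp_ge_add_one_self[of "- q ?x"] by simp
    then show "ennreal (\<psi> ?x) \<le> ennreal (exp t) * ennreal (\<psi> ?x * exp (- q ?x)) + ennreal ((q ?x - 1 + exp (- q ?x)) / g)"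
      using pw[of ?x] \<psi>0 by (simp flip: ennreal_mult ennreal_plus)
  qed
  also have "\<dots> = ennreal (exp t) * (\<integral>\<^sup>+Z. ennreal (\<psi> (?D V Z) * exp (- q (?D V Z))) \<partial>?\<mu>) + ennreal (spiked_KL n k r lam V V0 / g)"
    by (simp add: nn_integral_add nn_integral_cmult markov)
  also have "(\<integral>\<^sup>+Z. ennreal (\<psi> (?D V Z) * exp (- q (?D V Z))) \<partial>?\<mu>) = (\<integral>\<^sup>+Z. ennreal (\<psi> (?D V0 Z)) \<partial>?\<mu>)"
    by (rule transfer) (use \<psi>0 in auto)
  finally show ?thesis unfolding g_def .
qed

section \<open>Families of orthonormal systems\<close>

definition orthonormal :: "nat \<Rightarrow> nat \<Rightarrow> (nat \<Rightarrow> nat \<Rightarrow> real) \<Rightarrow> bool" where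
  "orthonormal M j v \<longleftrightarrow> (\<forall>a<j. \<forall>b<j. dotp {..<M} (v a) (v b) = (if a = b then 1 else 0))"

lemma orthonormalD:
  "orthonormal M j v \<Longrightarrow> a < j \<Longrightarrow> b < j \<Longrightarrow> dotp {..<M} (v a) (v b) = (if a = b then 1 else 0)"
  by (simp add: orthonormal_def)

lemma dotp_diff_right: "dotp I u (\<lambda>i. x i - y i) = dotp I u x - dotp I u y"
  by (simp add: dotp_def right_diff_distrib sum_subtractf)

lemma dotp_sum_right: "dotp I u (\<lambda>i. \<Sum>b\<in>B. c b * y b i) = (\<Sum>b\<in>B. c b * dotp I u (y b))"
  unfolding dotp_def sum_distrib_left by (subst sum.swap) (simp add: mult_ac)

lemma dotp_scale_right: "dotp I u (\<lambda>i. c * x i) = c * dotp I u x"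
  by (simp add: dotp_def sum_distrib_left mult_ac)

lemma dotp_unit_right: "finite I \<Longrightarrow> j \<in> I \<Longrightarrow> dotp I u (\<lambda>i. if i = j then 1 else 0) = u j"
  by (simp add: dotp_def if_distrib[of "(*) _"] cong: if_cong)

text \<open>By a trace count some coordinate vector lies outside the span of the given vectors.\<close>
lemma ex_unit_orthogonal:
  assumes v: "orthonormal M j v" and j: "j < M"
  shows "\<exists>w. dotp {..<M} w w = 1 \<and> (\<forall>a<j. dotp {..<M} (v a) w = 0)"
proof -
  have "(\<Sum>i<M. 1 - (\<Sum>b<j. (v b i)\<^sup>2)) = real M - (\<Sum>b<j. dotp {..<M} (v b) (v b))"
    by (simp add: sum_subtractf dotp_def power2_eq_square) (rule sum.swap)
  also have "(\<Sum>b<j. dotp {..<M} (v b) (v b)) = real j"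
    using orthonormalD[OF v] by simp
  finally have "0 < (\<Sum>i<M. 1 - (\<Sum>b<j. (v b i)\<^sup>2))" using j by simp
  then obtain i where i: "i < M" "0 < 1 - (\<Sum>b<j. (v b i)\<^sup>2)"
    by (metis (no_types, lifting) lessThan_iff linorder_not_le sum_nonpos)
  \<comment> \<open>The projection of the coordinate vector \<open>i\<close> onto the orthogonal
    complement. Its squared length equals its own coordinate \<open>i\<close>, which was just seen
    to be positive.\<close>
  define w0 where "w0 m = (if m = i then 1 else 0) - (\<Sum>b<j. v b i * v b m)" for m
  have right: "dotp {..<M} u w0 = u i - (\<Sum>b<j. v b i * dotp {..<M} u (v b))" for u
    unfolding w0_def[abs_def] dotp_diff_right dotp_sum_right using i by (simp add: dotp_unit_right)
  have orth: "dotp {..<M} (v a) w0 = 0" if a: "a < j" for a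
  proof -
    have "(\<Sum>b<j. v b i * dotp {..<M} (v a) (v b)) = (\<Sum>b<j. if b = a then v a i else 0)"
      using a by (intro sum.cong refl) (simp add: orthonormalD[OF v])
    then show ?thesis unfolding right using a by simp
  qed
  have "dotp {..<M} w0 w0 = w0 i"
    unfolding right using orth by (simp add: dotp_commute[of _ w0 "v a" for a])
  also have "\<dots> = 1 - (\<Sum>b<j. (v b i)\<^sup>2)" by (simp add: w0_def power2_eq_square)
  finally have norm: "0 < dotp {..<M} w0 w0" using i by simp
  define c where "c = 1 / sqrt (dotp {..<M} w0 w0)"
  have cc: "c * c * dotp {..<M} w0 w0 = 1" using norm by (simp add: c_def)
  show ?thesis
  proof (intro exI conjI allI impI)
    show "dotp {..<M} (\<lambda>i. c * w0 i) (\<lambda>i. c * w0 i) = 1"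
      unfolding dotp_scale_right by (subst dotp_commute) (unfold dotp_scale_right, simp add: mult.assoc[symmetric] cc)
    show "dotp {..<M} (v a) (\<lambda>i. c * w0 i) = 0" if "a < j" for a
      unfolding dotp_scale_right using orth[OF that] by simp
  qed
qed

lemma orthonormal_extend:
  assumes v: "orthonormal M j v" and "j + d \<le> M"
  shows "\<exists>v'. (\<forall>a<j. v' a = v a) \<and> orthonormal M (j + d) v'"
  using assms(2)
proof (induction d)
  case 0
  then show ?case using v by auto
next
  case (Suc d)
  then obtain v' where v': "\<forall>a<j. v' a = v a" "orthonormal M (j + d) v'" by auto
  obtain w where w: "dotp {..<M} w w = 1" "\<forall>a<j + d. dotp {..<M} (v' a) w = 0"
    using ex_unit_orthogonal[OF v'(2)] Suc.prems by auto
  have "\<forall>a<j + d. dotp {..<M} w (v' a) = 0"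
    using w(2) dotp_commute by metis
  then have "orthonormal M (j + Suc d) (v'(j + d := w))"
    using v'(2) w by (auto simp: orthonormal_def less_Suc_eq)
  moreover have "\<forall>a<j. (v'(j + d := w)) a = v a" using v' by auto
  ultimately show ?case by blast
qed

lemma bessel:
  assumes b: "orthonormal M d b"
  shows "(\<Sum>i<d. (dotp {..<M} (b i) y)\<^sup>2) \<le> (\<Sum>m<M. (y m)\<^sup>2)"
proof -
  define z where "z m = y m - (\<Sum>i<d. dotp {..<M} (b i) y * b i m)" for m
  have right: "dotp {..<M} u z = dotp {..<M} u y - (\<Sum>i<d. dotp {..<M} (b i) y * dotp {..<M} u (b i))" for u
    unfolding z_def[abs_def] dotp_diff_right dotp_sum_right ..
  have orth: "dotp {..<M} (b a) z = 0" if a: "a < d" for a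
  proof -
    have "(\<Sum>i<d. dotp {..<M} (b i) y * dotp {..<M} (b a) (b i)) = (\<Sum>i<d. if i = a then dotp {..<M} (b a) y else 0)"
      using a by (intro sum.cong refl) (simp add: orthonormalD[OF b])
    then show ?thesis unfolding right using a by simp
  qed
  have "0 \<le> dotp {..<M} z z" unfolding dotp_def by (intro sum_nonneg) simp
  also have "\<dots> = dotp {..<M} z y" unfolding right using orth by (simp add: dotp_commute[of _ z "b i" for i])
  also have "\<dots> = dotp {..<M} y y - (\<Sum>i<d. (dotp {..<M} (b i) y)\<^sup>2)"
    by (subst dotp_commute, unfold right) (simp add: dotp_commute[of _ y "b i" for i] power2_eq_square)
  finally show ?thesis by (simp add: dotp_def power2_eq_square)
qed

section \<open>Exponential moments of random sign combinations\<close>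

lemma prod_add_Pow:
  fixes f g :: "'a \<Rightarrow> 'b::comm_semiring_1"
  assumes "finite A"
  shows "(\<Sum>S\<in>Pow A. \<Prod>i\<in>A. if i \<in> S then f i else g i) = (\<Prod>i\<in>A. f i + g i)"
proof -
  have "(\<Prod>i\<in>A. if i \<in> S then f i else g i) = prod f S * prod g (A - S)" if "S \<in> Pow A" for S
    using assms that by (simp add: prod.If_cases Int_absorb1 Diff_eq)
  then show ?thesis by (simp add: prod_add[OF assms])
qed

text \<open>At least one of the signs 1 and -1 has distance at least 1 from \<open>y\<close>; the
  term of the other sign is bounded by 1.\<close>

lemma exp_sign_sum_le:
  fixes \<kappa> y :: real
  assumes "0 \<le> \<kappa>"
  shows "exp (- (\<kappa> * (1 - y)\<^sup>2)) + exp (- (\<kappa> * (- 1 - y)\<^sup>2)) \<le> 1 + exp (- \<kappa>)"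
proof -
  have *: "exp (- (\<kappa> * z\<^sup>2)) \<le> 1" "1 \<le> \<bar>z\<bar> \<Longrightarrow> exp (- (\<kappa> * z\<^sup>2)) \<le> exp (- \<kappa>)" for z :: real
  proof -
    show "exp (- (\<kappa> * z\<^sup>2)) \<le> 1" using assms by simp
    assume "1 \<le> \<bar>z\<bar>"
    then have "1 \<le> z\<^sup>2" using one_le_power[of "\<bar>z\<bar>" 2] by simp
    then show "exp (- (\<kappa> * z\<^sup>2)) \<le> exp (- \<kappa>)" using assms mult_left_mono[of 1 "z\<^sup>2" \<kappa>] by simp
  qed
  show ?thesis
  proof (cases "0 \<le> y")
    case True
    then have "1 \<le> \<bar>- 1 - y\<bar>" by simp
    from *(1)[of "1 - y"] *(2)[OF this] show ?thesis by linarith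
  next
    case False
    then have "1 \<le> \<bar>1 - y\<bar>" by simp
    from *(1)[of "- 1 - y"] *(2)[OF this] show ?thesis by linarith
  qed
qed

text \<open>The set \<open>S\<close> holds the indices with sign +1, so a uniform choice of signs is
  a uniform subset; dividing by sqrt d gives unit length when \<open>b\<close> is
  orthonormal.\<close>

definition sign_comb :: "nat \<Rightarrow> (nat \<Rightarrow> nat \<Rightarrow> real) \<Rightarrow> nat set \<Rightarrow> nat \<Rightarrow> real" where
  "sign_comb d b S = (\<lambda>m. \<Sum>i<d. ((if i \<in> S then 1 else -1) / sqrt d) * b i m)"

lemma dotp_sign_comb:
  assumes b: "orthonormal M d b" and i: "i < d"
  shows "dotp {..<M} (b i) (sign_comb d b S) = (if i \<in> S then 1 else -1) / sqrt d"
proof -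
  have "dotp {..<M} (b i) (sign_comb d b S) = (\<Sum>i'<d. ((if i' \<in> S then 1 else -1) / sqrt d) * dotp {..<M} (b i) (b i'))"
    unfolding sign_comb_def dotp_sum_right ..
  also have "\<dots> = (\<Sum>i'<d. if i' = i then (if i \<in> S then 1 else -1) / sqrt d else 0)"
    using i by (intro sum.cong refl) (simp add: orthonormalD[OF b])
  finally show ?thesis using i by simp
qed

lemma sign_comb_unit:
  assumes b: "orthonormal M d b" and d: "0 < d"
  shows "dotp {..<M} (sign_comb d b S) (sign_comb d b S) = 1"
proof -
  have "dotp {..<M} (sign_comb d b S) (sign_comb d b S) = (\<Sum>i<d. ((if i \<in> S then 1 else -1) / sqrt d) * dotp {..<M} (sign_comb d b S) (b i))"
    by (subst (2) sign_comb_def) (rule dotp_sum_right)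
  also have "\<dots> = (\<Sum>i<d. 1 / d)"
    by (intro sum.cong refl) (simp add: dotp_commute[of _ "sign_comb d b S"] dotp_sign_comb[OF b])
  finally show ?thesis using d by simp
qed

text \<open>By Bessel only the components along \<open>b\<close> are kept. Multiplied by
  \<open>d\<close>, their squared errors are squared distances of single signs to fixed numbers, so
  the sum over sign patterns factors into two-term sums.\<close>

lemma sum_exp_sign_comb_le:
  assumes b: "orthonormal M d b" and d: "0 < d" and \<kappa>: "0 \<le> \<kappa>"
  shows "(\<Sum>S\<in>Pow {..<d}. exp (- (\<kappa> * d * (\<Sum>m<M. (sign_comb d b S m - T m)\<^sup>2)))) \<le> (1 + exp (- \<kappa>)) ^ d"
proof -
  define y where "y i = sqrt d * dotp {..<M} (b i) T" for i
  have "exp (- (\<kappa> * d * (\<Sum>m<M. (sign_comb d b S m - T m)\<^sup>2)))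
     \<le> (\<Prod>i<d. if i \<in> S then exp (- (\<kappa> * (1 - y i)\<^sup>2)) else exp (- (\<kappa> * (- 1 - y i)\<^sup>2)))" for S
  proof -
    have "(\<Sum>i<d. ((if i \<in> S then 1 else -1) - y i)\<^sup>2) = d * (\<Sum>i<d. (dotp {..<M} (b i) (\<lambda>m. sign_comb d b S m - T m))\<^sup>2)"
      unfolding sum_distrib_left
    proof (intro sum.cong refl)
      fix i assume i: "i \<in> {..<d}"
      have "dotp {..<M} (b i) (\<lambda>m. sign_comb d b S m - T m) = ((if i \<in> S then 1 else -1) - y i) / sqrt d"
        using i d by (simp add: dotp_diff_right dotp_sign_comb[OF b] y_def diff_divide_distrib)
      then show "((if i \<in> S then 1 else -1) - y i)\<^sup>2 = d * (dotp {..<M} (b i) (\<lambda>m. sign_comb d b S m - T m))\<^sup>2"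
        using d by (simp add: power_divide)
    qed
    also have "\<dots> \<le> d * (\<Sum>m<M. (sign_comb d b S m - T m)\<^sup>2)"
      by (intro mult_left_mono bessel[OF b]) simp
    finally have "\<kappa> * (\<Sum>i<d. ((if i \<in> S then 1 else -1) - y i)\<^sup>2) \<le> \<kappa> * (d * (\<Sum>m<M. (sign_comb d b S m - T m)\<^sup>2))"
      using \<kappa> by (intro mult_left_mono)
    then have "exp (- (\<kappa> * d * (\<Sum>m<M. (sign_comb d b S m - T m)\<^sup>2))) \<le> exp (- (\<kappa> * (\<Sum>i<d. ((if i \<in> S then 1 else -1) - y i)\<^sup>2)))"
      by (simp add: mult.assoc)
    also have "\<dots> = (\<Prod>i<d. exp (- (\<kappa> * ((if i \<in> S then 1 else -1) - y i)\<^sup>2)))"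
      by (subst exp_sum[symmetric]) (simp_all add: sum_distrib_left sum_negf)
    also have "\<dots> = (\<Prod>i<d. if i \<in> S then exp (- (\<kappa> * (1 - y i)\<^sup>2)) else exp (- (\<kappa> * (- 1 - y i)\<^sup>2)))"
      by (intro prod.cong) auto
    finally show ?thesis .
  qed
  then have "(\<Sum>S\<in>Pow {..<d}. exp (- (\<kappa> * d * (\<Sum>m<M. (sign_comb d b S m - T m)\<^sup>2))))
    \<le> (\<Sum>S\<in>Pow {..<d}. \<Prod>i<d. if i \<in> S then exp (- (\<kappa> * (1 - y i)\<^sup>2)) else exp (- (\<kappa> * (- 1 - y i)\<^sup>2)))"
    by (rule sum_mono)
  also have "\<dots> = (\<Prod>i<d. exp (- (\<kappa> * (1 - y i)\<^sup>2)) + exp (- (\<kappa> * (- 1 - y i)\<^sup>2)))"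
    by (rule prod_add_Pow) simp
  also have "\<dots> \<le> (\<Prod>i<d. 1 + exp (- \<kappa>))"
    by (intro prod_mono conjI exp_sign_sum_le \<kappa> add_nonneg_nonneg) auto
  finally show ?thesis by simp
qed

text \<open>The columns are chosen one after the other, each new column being a random sign combination of an
  orthonormal system in the orthogonal complement of the previous ones. Whatever the previous columns
  are, the sum over the new signs has the same bound, so no concentration for random matrices is needed.\<close>
lemma ex_orthonormal_family:
  assumes d: "0 < d" and \<kappa>: "0 \<le> \<kappa>" and m: "m + d \<le> M + 1"
  shows "\<exists>(N::nat) G. 0 < N \<and> (\<forall>w<N. orthonormal M m (G w)) \<and>
    (\<forall>T. (\<Sum>w<N. exp (- (\<kappa> * d * (\<Sum>a<m. \<Sum>i<M. (G w a i - T a i)\<^sup>2)))) \<le> N * ((1 + exp (- \<kappa>)) / 2) ^ (d * m))"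
  using m
proof (induction m)
  case 0
  have "\<forall>w<1::nat. orthonormal M 0 ((\<lambda>_ _ _. 0) w)" by (simp add: orthonormal_def)
  then show ?case by (intro exI[of _ "1::nat"] exI[of _ "\<lambda>_ _ _. 0"]) simp
next
  case (Suc m)
  then obtain N :: nat and G where N: "0 < N" and G: "\<And>w. w < N \<Longrightarrow> orthonormal M m (G w)"
    and sb: "\<And>T. (\<Sum>w<N. exp (- (\<kappa> * d * (\<Sum>a<m. \<Sum>i<M. (G w a i - T a i)\<^sup>2)))) \<le> N * ((1 + exp (- \<kappa>)) / 2) ^ (d * m)"
    by auto
  have "\<exists>b. orthonormal M d b \<and> (\<forall>a<m. \<forall>i<d. dotp {..<M} (G w a) (b i) = 0)" if w: "w < N" for w
  proof -
    \<comment> \<open>Only the \<open>m\<close> columns already chosen must leave room for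
      \<open>d\<close> directions, that is m + d \<le> M; this is the hypothesis for
      \<open>Suc m\<close>, with its + 1.\<close>
    obtain v' where v': "\<forall>a<m. v' a = G w a" "orthonormal M (m + d) v'"
      using orthonormal_extend[OF G[OF w], of d] Suc.prems by auto
    have "orthonormal M d (\<lambda>i. v' (m + i))" using v'(2) by (simp add: orthonormal_def)
    moreover have "\<forall>a<m. \<forall>i<d. dotp {..<M} (G w a) (v' (m + i)) = 0"
    proof (intro allI impI)
      fix a i assume "a < m" "i < d"
      then show "dotp {..<M} (G w a) (v' (m + i)) = 0"
        using orthonormalD[OF v'(2), of a "m + i"] v'(1) by simp
    qed
    ultimately show ?thesis by blast
  qed
  then obtain b where b: "\<And>w. w < N \<Longrightarrow> orthonormal M d (b w)"
    and Gb: "\<And>w a i. w < N \<Longrightarrow> a < m \<Longrightarrow> i < d \<Longrightarrow> dotp {..<M} (G w a) (b w i) = 0"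
    by metis
  define H where "H = (\<lambda>(w, S). (G w)(m := sign_comb d (b w) S))"
  define \<Omega> where "\<Omega> = {..<N} \<times> Pow {..<d}"
  have "finite \<Omega>" by (simp add: \<Omega>_def)
  \<comment> \<open>The pairs of an old system and a sign pattern are renumbered by the naturals
    below their count.\<close>
  then obtain h where h: "bij_betw h {..<card \<Omega>} \<Omega>"
    using ex_bij_betw_nat_finite atLeast0LessThan by metis
  have card: "card \<Omega> = N * 2 ^ d" by (simp add: \<Omega>_def card_cartesian_product card_Pow)
  show ?case
  proof (intro exI conjI allI impI)
    show "0 < card \<Omega>" using N by (simp add: card)
  next
    fix w' assume "w' < card \<Omega>"
    then have "h w' \<in> \<Omega>" using bij_betwE[OF h] by blast
    then obtain w S where wS: "h w' = (w, S)" "w < N" by (auto simp: \<Omega>_def)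
    have "dotp {..<M} (G w a) (sign_comb d (b w) S) = 0" if "a < m" for a
      unfolding sign_comb_def dotp_sum_right using Gb[OF wS(2) that] by simp
    moreover from this have "dotp {..<M} (sign_comb d (b w) S) (G w a) = 0" if "a < m" for a
      using that dotp_commute by metis
    ultimately show "orthonormal M (Suc m) (H (h w'))"
      using G[OF wS(2)] sign_comb_unit[OF b[OF wS(2)] d]
      by (auto simp: orthonormal_def wS H_def less_Suc_eq)
  next
    fix T :: "nat \<Rightarrow> nat \<Rightarrow> real"
    let ?E = "\<lambda>w. exp (- (\<kappa> * d * (\<Sum>a<m. \<Sum>i<M. (G w a i - T a i)\<^sup>2)))"
    let ?F = "\<lambda>w S. exp (- (\<kappa> * d * (\<Sum>i<M. (sign_comb d (b w) S i - T m i)\<^sup>2)))"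
    have "(\<Sum>w'<card \<Omega>. exp (- (\<kappa> * d * (\<Sum>a<Suc m. \<Sum>i<M. (H (h w') a i - T a i)\<^sup>2))))
       = (\<Sum>p\<in>\<Omega>. exp (- (\<kappa> * d * (\<Sum>a<Suc m. \<Sum>i<M. (H p a i - T a i)\<^sup>2))))"
      by (rule sum.reindex_bij_betw[OF h])
    also have "\<dots> = (\<Sum>(w, S)\<in>\<Omega>. ?E w * ?F w S)"
      by (intro sum.cong refl) (auto simp: H_def distrib_left simp flip: exp_add)
    also have "\<dots> = (\<Sum>w<N. ?E w * (\<Sum>S\<in>Pow {..<d}. ?F w S))"
      unfolding \<Omega>_def by (subst sum.cartesian_product[symmetric]) (simp add: sum_distrib_left)
    also have "\<dots> \<le> (\<Sum>w<N. ?E w * (1 + exp (- \<kappa>)) ^ d)"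
      by (intro sum_mono mult_left_mono sum_exp_sign_comb_le b d \<kappa>) auto
    also have "\<dots> \<le> N * ((1 + exp (- \<kappa>)) / 2) ^ (d * m) * (1 + exp (- \<kappa>)) ^ d"
      unfolding sum_distrib_right[symmetric] by (intro mult_right_mono sb) (simp add: add_nonneg_nonneg)
    \<comment> \<open>The 2^d sign patterns in the count supply the denominators of \<open>d\<close>
      new factors (1 + exp (- \<kappa>)) / 2.\<close>
    also have "\<dots> = card \<Omega> * ((1 + exp (- \<kappa>)) / 2) ^ (d * Suc m)"
      by (simp add: card power_add power_divide field_simps)
    finally show "(\<Sum>w'<card \<Omega>. exp (- (\<kappa> * d * (\<Sum>a<Suc m. \<Sum>i<M. (H (h w') a i - T a i)\<^sup>2)))) \<le> card \<Omega> * ((1 + exp (- \<kappa>)) / 2) ^ (d * Suc m)" .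
  qed
qed

section \<open>Frames spanned by rotated partial isometries\<close>

text \<open>This is U U' U = U. The condition is stable under transposition, so it covers both
  orthonormal columns and orthonormal rows, padded by zeros.\<close>

definition partial_isometry :: "nat \<Rightarrow> nat \<Rightarrow> (nat \<Rightarrow> nat \<Rightarrow> real) \<Rightarrow> bool" where
  "partial_isometry p r U \<longleftrightarrow> (\<forall>l<p. \<forall>a<r. (\<Sum>b<r. U l b * (\<Sum>i<p. U i b * U i a)) = U l a)"

text \<open>In block form this is the matrix with upper block \<open>I - (1 - c) U'U\<close> and lower block \<open>s U\<close>.
  For a partial isometry \<open>U\<close> and \<open>c\<^sup>2 + s\<^sup>2 = 1\<close> it has orthonormal columns, whichever of \<open>r\<close>, \<open>k - r\<close>
  is larger.\<close>
definition rotated_frame :: "nat \<Rightarrow> nat \<Rightarrow> real \<Rightarrow> real \<Rightarrow> (nat \<Rightarrow> nat \<Rightarrow> real) \<Rightarrow> nat \<Rightarrow> nat \<Rightarrow> real" where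
  "rotated_frame k r s c U j a =
    (if a < r \<and> j < r then (if j = a then 1 else 0) - (1 - c) * (\<Sum>l<k - r. U l j * U l a)
     else if a < r \<and> j < k then s * U (j - r) a else 0)"

lemma rotated_frame_upper:
  "a < r \<Longrightarrow> j < r \<Longrightarrow> rotated_frame k r s c U j a = (if j = a then 1 else 0) - (1 - c) * (\<Sum>l<k - r. U l j * U l a)"
  by (simp add: rotated_frame_def)

lemma rotated_frame_lower:
  "a < r \<Longrightarrow> l < k - r \<Longrightarrow> rotated_frame k r s c U (r + l) a = s * U l a"
  by (simp add: rotated_frame_def)

lemma sum_split_at:
  fixes f :: "nat \<Rightarrow> real"
  assumes "r \<le> k"
  shows "(\<Sum>j<k. f j) = (\<Sum>j<r. f j) + (\<Sum>l<k - r. f (r + l))"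
  using sum.atLeastLessThan_concat[of 0 r k f] assms
  by (simp add: lessThan_atLeast0 sum.atLeastLessThan_shift_0[of f r])

text \<open>The matrix Q = U'U is a symmetric idempotent, so the Gram matrix (I - (1 - c) Q)^2 + s^2
  Q equals I + (c^2 + s^2 - 1) Q = I.\<close>

lemma rotated_frame_stiefel:
  assumes U: "partial_isometry (k - r) r U" and cs: "c\<^sup>2 + s\<^sup>2 = 1" and r: "r \<le> k"
  shows "rotated_frame k r s c U \<in> stiefel k r"
proof -
  define Q where "Q j a = (\<Sum>l<k - r. U l j * U l a)" for j a
  have QQ: "(\<Sum>j<r. Q j a * Q j b) = Q a b" if ab: "a < r" "b < r" for a b
  proof -
    have "(\<Sum>j<r. Q j a * Q j b) = (\<Sum>l<k - r. U l a * (\<Sum>j<r. U l j * Q j b))"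
      unfolding Q_def[of _ a] sum_distrib_right sum_distrib_left by (subst sum.swap) (simp add: mult_ac)
    also have "\<dots> = (\<Sum>l<k - r. U l a * U l b)"
      using U ab by (intro sum.cong refl) (simp add: partial_isometry_def Q_def)
    finally show ?thesis by (simp add: Q_def)
  qed
  have "(\<Sum>j<k. rotated_frame k r s c U j a * rotated_frame k r s c U j b) = (if a = b then 1 else 0)" if ab: "a < r" "b < r" for a b
  proof -
    let ?d = "\<lambda>j a::nat. if j = a then 1 else 0 :: real"
    have "(\<Sum>j<k. rotated_frame k r s c U j a * rotated_frame k r s c U j b)
      = (\<Sum>j<r. (?d j a - (1 - c) * Q j a) * (?d j b - (1 - c) * Q j b)) + (\<Sum>l<k - r. s * U l a * (s * U l b))"
      unfolding sum_split_at[OF r] using ab by (simp add: rotated_frame_upper rotated_frame_lower Q_def cong: sum.cong_simp)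
    also have "(\<Sum>l<k - r. s * U l a * (s * U l b)) = s\<^sup>2 * Q a b"
      by (simp add: Q_def sum_distrib_left power2_eq_square mult_ac)
    also have "(\<Sum>j<r. (?d j a - (1 - c) * Q j a) * (?d j b - (1 - c) * Q j b))
      = (\<Sum>j<r. (if j = a then ?d a b - (1 - c) * Q a b else 0) - (if j = b then (1 - c) * Q b a else 0) + (1 - c)\<^sup>2 * (Q j a * Q j b))"
      by (intro sum.cong refl) (auto simp: algebra_simps power2_eq_square)
    also have "\<dots> = ?d a b - (1 - c) * Q a b - (1 - c) * Q b a + (1 - c)\<^sup>2 * Q a b"
      using ab by (simp add: sum.distrib sum_subtractf QQ flip: sum_distrib_left)
    also have "Q b a = Q a b" by (simp add: Q_def mult.commute)
    also have "s\<^sup>2 = 1 - c\<^sup>2" using cs by simp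
    finally show ?thesis by (simp add: algebra_simps power2_eq_square)
  qed
  then show ?thesis using r by (auto simp: stiefel_def rotated_frame_def)
qed

text \<open>For s = 0 and c = 1 the frame consists of the first \<open>r\<close> coordinate vectors,
  so the cross products with it form the upper block. Since the columns have unit length, the
  squared norm of that block is \<open>r\<close> minus that of the lower block s U.\<close>

lemma spiked_KL_rotated_frame:
  assumes U: "partial_isometry (k - r) r U" and cs: "c\<^sup>2 + s\<^sup>2 = 1" and r: "r \<le> k"
  shows "spiked_KL n k r lam (rotated_frame k r s c U) (rotated_frame k r 0 1 U)
    = real n * h lam / 2 * (s\<^sup>2 * (\<Sum>l<k - r. \<Sum>a<r. (U l a)\<^sup>2))"
proof -
  let ?V = "rotated_frame k r s c U"
  have "(\<Sum>j<k. ?V j b * rotated_frame k r 0 1 U j a) = ?V a b" if "a < r" "b < r" for a b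
  proof -
    have "(\<Sum>j<k. ?V j b * rotated_frame k r 0 1 U j a) = (\<Sum>j<r. ?V j b * (if j = a then 1 else 0))"
      unfolding sum_split_at[OF r] using that
      by (simp add: rotated_frame_upper[of _ _ _ k 0] rotated_frame_lower[of _ _ _ k 0] cong: sum.cong_simp)
    also have "\<dots> = (\<Sum>j<r. if j = a then ?V a b else 0)"
      by (intro sum.cong refl) auto
    finally show ?thesis using that by simp
  qed
  then have "(\<Sum>a<r. \<Sum>b<r. (\<Sum>j<k. ?V j b * rotated_frame k r 0 1 U j a)\<^sup>2) = (\<Sum>a<r. \<Sum>b<r. (?V a b)\<^sup>2)"
    by (intro sum.cong refl) auto
  also have "\<dots> = (\<Sum>b<r. (\<Sum>j<k. ?V j b * ?V j b) - s\<^sup>2 * (\<Sum>l<k - r. (U l b)\<^sup>2))"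
    by (subst sum.swap, intro sum.cong refl)
      (simp add: sum_split_at[OF r] rotated_frame_lower power2_eq_square sum_distrib_left mult_ac cong: sum.cong_simp)
  also have "\<dots> = (\<Sum>b<r. 1 - s\<^sup>2 * (\<Sum>l<k - r. (U l b)\<^sup>2))"
    using rotated_frame_stiefel[OF assms] by (intro sum.cong refl) (simp add: stiefel_def)
  also have "\<dots> = real r - s\<^sup>2 * (\<Sum>l<k - r. \<Sum>a<r. (U l a)\<^sup>2)"
    by (subst sum.swap[where A = "{..<k - r}"]) (simp add: sum_subtractf flip: sum_distrib_left)
  finally show ?thesis by (simp add: spiked_KL_def)
qed

text \<open>The lower left block of V V' is s U (I - (1 - c) U'U), which U U' U = U turns into s c
  U. The loss is bounded below by its part on this block.\<close>

lemma frob_loss_rotated_frame: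
  assumes U: "partial_isometry (k - r) r U" and r: "r \<le> k"
  shows "(\<Sum>l<k - r. \<Sum>a<r. (proj k r W (r + l) a - s * c * U l a)\<^sup>2) \<le> frob_loss k r W (rotated_frame k r s c U)"
proof -
  let ?V = "rotated_frame k r s c U"
  have pr: "proj k r ?V (r + l) a = s * c * U l a" if la: "l < k - r" "a < r" for l a
  proof -
    have "proj k r ?V (r + l) a = (\<Sum>b<r. (if b = a then s * U l a else 0) - s * (1 - c) * (U l b * (\<Sum>i<k - r. U i b * U i a)))"
      unfolding proj_def
    proof (intro sum.cong refl)
      fix b assume "b \<in> {..<r}"
      then have "?V (r + l) b * ?V a b = s * U l b * ((if a = b then 1 else 0) - (1 - c) * (\<Sum>i<k - r. U i b * U i a))"
        using la by (simp add: rotated_frame_upper rotated_frame_lower mult.commute[of "U _ a"])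
      also have "\<dots> = (if b = a then s * U l a else 0) - s * (1 - c) * (U l b * (\<Sum>i<k - r. U i b * U i a))"
        by (auto simp: right_diff_distrib mult_ac)
      finally show "?V (r + l) b * ?V a b = (if b = a then s * U l a else 0) - s * (1 - c) * (U l b * (\<Sum>i<k - r. U i b * U i a))" .
    qed
    also have "\<dots> = s * U l a - s * (1 - c) * (\<Sum>b<r. U l b * (\<Sum>i<k - r. U i b * U i a))"
      using la by (simp add: sum_subtractf flip: sum_distrib_left)
    also have "(\<Sum>b<r. U l b * (\<Sum>i<k - r. U i b * U i a)) = U l a"
      using U la by (simp add: partial_isometry_def)
    finally show ?thesis by (simp add: algebra_simps)
  qed
  let ?f = "\<lambda>i j. (proj k r W i j - proj k r ?V i j)\<^sup>2"
  have "(\<Sum>l<k - r. \<Sum>a<r. (proj k r W (r + l) a - s * c * U l a)\<^sup>2) = (\<Sum>l<k - r. \<Sum>a<r. ?f (r + l) a)"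
    by (intro sum.cong refl) (simp add: pr)
  also have "\<dots> \<le> (\<Sum>l<k - r. \<Sum>a<k. ?f (r + l) a)"
    using r by (intro sum_mono sum_mono2) auto
  also have "\<dots> \<le> (\<Sum>i<k. \<Sum>a<k. ?f i a)"
    unfolding sum_split_at[OF r, of "\<lambda>i. \<Sum>a<k. ?f i a"] by (simp add: sum_nonneg)
  finally show ?thesis unfolding frob_loss_def .
qed

text \<open>For \<open>r \<le> p\<close> the frames of \<open>ex_orthonormal_family\<close> are padded by zero columns, otherwise they are
  transposed and padded by zero rows.\<close>
lemma ex_partial_isometry_family:
  assumes d: "0 < d" and \<kappa>: "0 \<le> \<kappa>" and md: "m + d \<le> max r p + 1" and m: "m \<le> min r p"
  shows "\<exists>(N::nat) U. 0 < N \<and> (\<forall>w<N. partial_isometry p r (U w) \<and> (\<Sum>l<p. \<Sum>a<r. (U w l a)\<^sup>2) = real m) \<and>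
    (\<forall>T. (\<Sum>w<N. exp (- (\<kappa> * d * (\<Sum>l<p. \<Sum>a<r. (U w l a - T l a)\<^sup>2)))) \<le> N * ((1 + exp (- \<kappa>)) / 2) ^ (d * m))"
proof -
  obtain N :: nat and G where N: "0 < N" and G: "\<And>w. w < N \<Longrightarrow> orthonormal (max r p) m (G w)"
    and sb: "\<And>T. (\<Sum>w<N. exp (- (\<kappa> * d * (\<Sum>a<m. \<Sum>i<max r p. (G w a i - T a i)\<^sup>2)))) \<le> N * ((1 + exp (- \<kappa>)) / 2) ^ (d * m)"
    using ex_orthonormal_family[OF d \<kappa> md] by blast
  have GG: "(\<Sum>i<max r p. G w a i * G w b i) = (if a = b then 1 else 0)" if "w < N" "a < m" "b < m" for w a b
    using orthonormalD[OF G] that by (simp add: dotp_def)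
  have cut: "(\<Sum>b<q. if b < m then f b else 0) = (\<Sum>b<m. f b)" if "m \<le> q" for q and f :: "nat \<Rightarrow> real"
    using that by (intro sum.mono_neutral_cong_right) auto
  \<comment> \<open>Padding can only increase the squared distances to a given matrix, hence only
    decreases the exponentials.\<close>
  have sbU: "(\<Sum>w<N. exp (- (\<kappa> * d * F w))) \<le> N * ((1 + exp (- \<kappa>)) / 2) ^ (d * m)"
    if "\<And>w. w < N \<Longrightarrow> (\<Sum>a<m. \<Sum>i<max r p. (G w a i - T a i)\<^sup>2) \<le> F w" for F T
  proof -
    have "(\<Sum>w<N. exp (- (\<kappa> * d * F w))) \<le> (\<Sum>w<N. exp (- (\<kappa> * d * (\<Sum>a<m. \<Sum>i<max r p. (G w a i - T a i)\<^sup>2))))"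
      using that \<kappa> by (intro sum_mono) (simp add: mult_left_mono)
    then show ?thesis using sb[of T] by linarith
  qed
  show ?thesis
  proof (cases "r \<le> p")
    case True
    then have M: "max r p = p" and mr: "m \<le> r" using m by auto
    define U where "U w l a = (if a < m then G w a l else 0)" for w l a
    have "partial_isometry p r (U w)" if w: "w < N" for w
      unfolding partial_isometry_def
    proof (intro allI impI)
      fix l a assume la: "l < p" "a < r"
      have "(\<Sum>b<r. U w l b * (\<Sum>i<p. U w i b * U w i a)) = (\<Sum>b<r. if b = a then U w l a else 0)"
        using GG[OF w] by (intro sum.cong refl) (auto simp: U_def M)
      then show "(\<Sum>b<r. U w l b * (\<Sum>i<p. U w i b * U w i a)) = U w l a" using la by simp
    qed
    moreover have "(\<Sum>l<p. \<Sum>a<r. (U w l a)\<^sup>2) = real m" if w: "w < N" for w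
    proof -
      have "(\<Sum>l<p. \<Sum>a<r. (U w l a)\<^sup>2) = (\<Sum>a<r. if a < m then 1 else 0)"
        using GG[OF w] by (subst sum.swap, intro sum.cong refl) (auto simp: U_def M power2_eq_square)
      then show ?thesis by (simp add: cut[OF mr])
    qed
    moreover have "(\<Sum>w<N. exp (- (\<kappa> * d * (\<Sum>l<p. \<Sum>a<r. (U w l a - T l a)\<^sup>2)))) \<le> N * ((1 + exp (- \<kappa>)) / 2) ^ (d * m)" for T
    \<comment> \<open>The vectors of \<open>G\<close> are columns of \<open>U\<close> here, so the
      bound is used for the transpose of \<open>T\<close>.\<close>
    proof (rule sbU)
      fix w
      have "(\<Sum>a<m. \<Sum>i<max r p. (G w a i - T i a)\<^sup>2) = (\<Sum>i<p. \<Sum>a<m. (U w i a - T i a)\<^sup>2)"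
        unfolding M by (subst sum.swap) (simp add: U_def)
      also have "\<dots> \<le> (\<Sum>i<p. \<Sum>a<r. (U w i a - T i a)\<^sup>2)"
        using mr by (intro sum_mono sum_mono2) auto
      finally show "(\<Sum>a<m. \<Sum>i<max r p. (G w a i - T i a)\<^sup>2) \<le> (\<Sum>i<p. \<Sum>a<r. (U w i a - T i a)\<^sup>2)" .
    qed
    ultimately show ?thesis using N by blast
  next
    case False
    then have M: "max r p = r" and mp: "m \<le> p" using m by auto
    define U where "U w l a = (if l < m then G w l a else 0)" for w l a
    have "partial_isometry p r (U w)" if w: "w < N" for w
      unfolding partial_isometry_def
    proof (intro allI impI)
      fix l a assume la: "l < p" "a < r"
      \<comment> \<open>Now the rows are orthonormal or zero, so the product is regrouped as (U U')
        U.\<close>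
      have "(\<Sum>b<r. U w l b * (\<Sum>i<p. U w i b * U w i a)) = (\<Sum>i<p. (\<Sum>b<r. U w l b * U w i b) * U w i a)"
        unfolding sum_distrib_left sum_distrib_right by (subst sum.swap) (simp add: mult_ac)
      also have "\<dots> = (\<Sum>i<p. if i = l then U w l a else 0)"
        using GG[OF w] by (intro sum.cong refl) (auto simp: U_def M)
      finally show "(\<Sum>b<r. U w l b * (\<Sum>i<p. U w i b * U w i a)) = U w l a" using la by simp
    qed
    moreover have "(\<Sum>l<p. \<Sum>a<r. (U w l a)\<^sup>2) = real m" if w: "w < N" for w
    proof -
      have "(\<Sum>l<p. \<Sum>a<r. (U w l a)\<^sup>2) = (\<Sum>l<p. if l < m then 1 else 0)"
        using GG[OF w] by (intro sum.cong refl) (auto simp: U_def M power2_eq_square)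
      then show ?thesis by (simp add: cut[OF mp])
    qed
    moreover have "(\<Sum>w<N. exp (- (\<kappa> * d * (\<Sum>l<p. \<Sum>a<r. (U w l a - T l a)\<^sup>2)))) \<le> N * ((1 + exp (- \<kappa>)) / 2) ^ (d * m)" for T
    proof (rule sbU)
      fix w
      have "(\<Sum>l<m. \<Sum>i<max r p. (G w l i - T l i)\<^sup>2) = (\<Sum>l<m. \<Sum>i<r. (U w l i - T l i)\<^sup>2)"
        unfolding M by (simp add: U_def)
      also have "\<dots> \<le> (\<Sum>l<p. \<Sum>i<r. (U w l i - T l i)\<^sup>2)"
        using mp by (intro sum_mono2) (auto intro!: sum_nonneg)
      finally show "(\<Sum>l<m. \<Sum>i<max r p. (G w l i - T l i)\<^sup>2) \<le> (\<Sum>l<p. \<Sum>i<r. (U w l i - T l i)\<^sup>2)" .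
    qed
    ultimately show ?thesis using N by blast
  qed
qed

section \<open>The Bayes argument\<close>

lemma measurable_frob_loss_estimator:
  assumes "Vh \<in> estimators n k r"
  shows "(\<lambda>x. frob_loss k r (Vh x) V) \<in> borel_measurable (noise_space n k)"
proof -
  have [measurable]: "(\<lambda>x. Vh x a b) \<in> borel_measurable (noise_space n k)" for a b
    using assms by (simp add: estimators_def measurable_cong_sets[OF sets_noise_space refl])
  show ?thesis unfolding frob_loss_def proj_def by measurable
qed

text \<open>Success means loss below \<eta>. Under the common law of \<open>V0\<close> the success
  probabilities average to at most \<open>p\<close>, since one estimate cannot be close to many
  frames. Changing measure to each \<open>V w\<close> keeps the average at most 9/10, so some frame
  is missed with probability at least 1/10.\<close>

lemma ex_risk_ge:
  assumes Vh: "Vh \<in> estimators n k r" and lam: "0 < lam" and N: "0 < (N::nat)"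
    and V: "\<And>w. w < N \<Longrightarrow> V w \<in> stiefel k r" and V0: "V0 \<in> stiefel k r" and t: "0 < t"
    and KL: "\<And>w. w < N \<Longrightarrow> spiked_KL n k r lam (V w) V0 \<le> K" and K: "0 \<le> K"
    and \<beta>: "0 \<le> \<beta>" and \<eta>: "0 < \<eta>"
    and ball: "\<And>W. (\<Sum>w<N. exp (\<beta> * (\<eta> - frob_loss k r W (V w)))) \<le> N * p"
    and err: "exp t * p + K / (t - 1 + exp (- t)) \<le> 9 / 10"
  shows "\<exists>w<N. ennreal (\<eta> / 10) \<le> risk n k r Vh (V w) (\<lambda>_. lam)"
proof -
  let ?\<mu> = "noise_space n k" and ?D = "\<lambda>V. data n k r V (\<lambda>_. lam)"
  interpret prob_space ?\<mu> by (rule prob_space_noise_space)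
  define L where "L w x = frob_loss k r (Vh x) (V w)" for w x
  have [measurable]: "L w \<in> borel_measurable ?\<mu>" for w
    unfolding L_def[abs_def] by (rule measurable_frob_loss_estimator[OF Vh])
  note [measurable] = measurable_data[of n k r]
  define \<psi> where "\<psi> w x = (if L w x < \<eta> then 1 else 0 :: real)" for w x
  have \<psi>m[measurable]: "\<psi> w \<in> borel_measurable ?\<mu>" for w unfolding \<psi>_def[abs_def] by measurable
  have \<psi>01: "0 \<le> \<psi> w x" "\<psi> w x \<le> 1" for w x by (auto simp: \<psi>_def)
  define P where "P V w = (\<integral>Z. \<psi> w (?D V Z) \<partial>?\<mu>)" for V w
  have int: "integrable ?\<mu> (\<lambda>Z. \<psi> w (?D V Z))" for w V
    using \<psi>01 by (intro integrable_const_bound[of _ 1]) auto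
  have P: "(\<integral>\<^sup>+Z. ennreal (\<psi> w (?D V Z)) \<partial>?\<mu>) = ennreal (P V w)" for V w
    unfolding P_def using \<psi>01 by (intro nn_integral_eq_integral int) auto
  have P0: "0 \<le> P V w" for V w unfolding P_def using \<psi>01 by (intro Bochner_Integration.integral_nonneg) auto
  define g where "g = t - 1 + exp (- t)"
  have g: "0 < g" unfolding g_def by (rule exp_remainder_pos[OF t])
  have change: "P (V w) w \<le> exp t * P V0 w + K / g" if w: "w < N" for w
  proof -
    have "ennreal (P (V w) w) \<le> ennreal (exp t) * ennreal (P V0 w) + ennreal (spiked_KL n k r lam (V w) V0 / g)"
      using nn_integral_data_change_measure[OF V[OF w] V0 lam t \<psi>m \<psi>01] unfolding P g_def .
    also have "\<dots> \<le> ennreal (exp t) * ennreal (P V0 w) + ennreal (K / g)"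
      using KL[OF w] g by (intro add_left_mono ennreal_leI divide_right_mono) auto
    also have "\<dots> = ennreal (exp t * P V0 w + K / g)"
      using P0 K g by (simp add: ennreal_mult ennreal_plus)
    finally show ?thesis using ennreal_le_iff[of "exp t * P V0 w + K / g" "P (V w) w"] P0 K g by simp
  qed
  have "(\<Sum>w<N. P V0 w) = (\<integral>Z. (\<Sum>w<N. \<psi> w (?D V0 Z)) \<partial>?\<mu>)"
    unfolding P_def using int by (intro Bochner_Integration.integral_sum[symmetric]) auto
  also have "\<dots> \<le> (\<integral>Z. N * p \<partial>?\<mu>)"
  proof (rule integral_mono)
    fix Z
    \<comment> \<open>Exponential Markov inequality: on success the exponent is nonnegative. The
      estimate at the data is a single \<open>W\<close>, so \<open>ball\<close> applies
      pointwise.\<close>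
    have "\<psi> w x \<le> exp (\<beta> * (\<eta> - L w x))" for w x using \<beta> by (simp add: \<psi>_def)
    then have "(\<Sum>w<N. \<psi> w (?D V0 Z)) \<le> (\<Sum>w<N. exp (\<beta> * (\<eta> - L w (?D V0 Z))))"
      by (intro sum_mono)
    also have "\<dots> \<le> N * p" unfolding L_def by (rule ball)
    finally show "(\<Sum>w<N. \<psi> w (?D V0 Z)) \<le> N * p" .
  qed (use int in auto)
  also have "\<dots> = N * p" using prob_space by simp
  finally have S0: "(\<Sum>w<N. P V0 w) \<le> N * p" .
  have "(\<Sum>w<N. P (V w) w) \<le> (\<Sum>w<N. exp t * P V0 w + K / g)"
    using change by (intro sum_mono) auto
  also have "\<dots> = exp t * (\<Sum>w<N. P V0 w) + N * (K / g)"
    by (simp add: sum.distrib sum_distrib_left)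
  also have "\<dots> \<le> exp t * (N * p) + N * (K / g)"
    using S0 by (intro add_right_mono mult_left_mono) auto
  also have "\<dots> = N * (exp t * p + K / g)" by (simp add: algebra_simps)
  also have "\<dots> \<le> N * (9 / 10)"
    using err by (intro mult_left_mono) (auto simp: g_def)
  finally have S: "(\<Sum>w<N. P (V w) w) \<le> N * (9 / 10)" .
  have "\<exists>w<N. P (V w) w \<le> 9 / 10"
  proof (rule ccontr)
    assume "\<not> (\<exists>w<N. P (V w) w \<le> 9 / 10)"
    then have "(\<Sum>w<N. 9 / 10) < (\<Sum>w<N. P (V w) w)"
      using N by (intro sum_strict_mono) (auto simp: not_le)
    then show False using S by simp
  qed
  then obtain w where w: "w < N" "P (V w) w \<le> 9 / 10" by blast
  have "ennreal (\<eta> / 10) \<le> risk n k r Vh (V w) (\<lambda>_. lam)"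
  proof (rule ccontr)
    assume "\<not> ennreal (\<eta> / 10) \<le> risk n k r Vh (V w) (\<lambda>_. lam)"
    \<comment> \<open>A risk below the bound is finite, so the rest is a computation with
      reals.\<close>
    then have less: "risk n k r Vh (V w) (\<lambda>_. lam) < ennreal (\<eta> / 10)" by simp
    then obtain R where R: "risk n k r Vh (V w) (\<lambda>_. lam) = ennreal R" "0 \<le> R"
      by (cases "risk n k r Vh (V w) (\<lambda>_. lam)") auto
    have R': "(\<integral>\<^sup>+Z. ennreal (L w (?D (V w) Z)) \<partial>?\<mu>) = ennreal R"
      using R(1) unfolding risk_def L_def .
    have R10: "R < \<eta> / 10" using less R by (simp add: ennreal_less_iff)
    \<comment> \<open>Pointwise \<eta> \<le> \<eta> \<psi> + L, since either \<psi> = 1 or the loss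
      is at least \<eta>.\<close>
    have "ennreal \<eta> = (\<integral>\<^sup>+Z. ennreal \<eta> \<partial>?\<mu>)" using emeasure_space_1 by simp
    also have "\<dots> \<le> (\<integral>\<^sup>+Z. ennreal \<eta> * ennreal (\<psi> w (?D (V w) Z)) + ennreal (L w (?D (V w) Z)) \<partial>?\<mu>)"
      by (intro nn_integral_mono) (auto simp: \<psi>_def intro!: ennreal_leI)
    also have "\<dots> = ennreal \<eta> * ennreal (P (V w) w) + ennreal R"
      using R' by (simp add: nn_integral_add nn_integral_cmult P)
    also have "\<dots> = ennreal (\<eta> * P (V w) w + R)"
      using \<eta> P0 R by (simp add: ennreal_mult ennreal_plus)
    finally have "\<eta> \<le> \<eta> * P (V w) w + R"
      using ennreal_le_iff[of "\<eta> * P (V w) w + R" \<eta>] \<eta> P0 R by simp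
    moreover have "\<eta> * P (V w) w \<le> \<eta> * (9 / 10)" using w \<eta> by (intro mult_left_mono) auto
    ultimately show False using R10 by simp
  qed
  then show ?thesis using w by blast
qed

text \<open>A prior with small ball mass \<open>(3/5) ^ q\<close> tolerates a likelihood ratio \<open>(4/3) ^ q = exp t\<close>, and
  \<open>t - 1 + exp (- t) \<ge> q (ln (4/3) - 1/4)\<close>. The radius \<open>ball_const\<close> is such that the exponential moment
  with \<open>\<kappa> = ln 9\<close>, namely \<open>((1 + 1/9) / 2) ^ q = (5/9) ^ q\<close>, gives the mass \<open>(27/25 \<cdot> 5/9) ^ q = (3/5) ^ q\<close>.\<close>
definition kl_const :: real where "kl_const = (ln (4 / 3) - 1 / 4) / 10"

definition ball_const :: real where "ball_const = ln (27 / 25) / ln 9"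

lemma kl_const_bounds: "0 < kl_const" "kl_const \<le> 1 / 2"
proof -
  show "0 < kl_const" using exp_remainder_pos[of "ln (4/3)"] by (simp add: kl_const_def exp_minus)
  show "kl_const \<le> 1 / 2" using ln_le_minus_one[of "4/3::real"] by (simp add: kl_const_def)
qed

lemma ball_const_pos: "0 < ball_const"
  by (simp add: ball_const_def)

section \<open>Choice of the parameters and the final bound\<close>

lemma sup_risk_ge:
  assumes Vh: "Vh \<in> estimators n k r" and r: "1 \<le> r" "r < k" and n: "1 \<le> n" and lam: "0 < lam"
    and \<kappa>: "1 < \<kappa>"
  shows "ennreal (ball_const * kl_const / 40 * (real (min r (k - r)) * min 1 (real (max r (k - r)) / (real n * h lam))))
     \<le> (SUP p \<in> Theta0 \<kappa> k r lam. risk n k r Vh (fst p) (snd p))"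
proof -
  define m0 M where "m0 = min r (k - r)" and "M = max r (k - r)"
  \<comment> \<open>Rounding m0 / 2 up keeps m \<ge> 1 even for m0 = 1, while \<open>d\<close> uses
    all the room in m + d \<le> M + 1; from 2 m \<le> M + 1 follows 2 d \<ge> M.\<close>
  define m where "m = (m0 + 1) div 2"
  define d where "d = M + 1 - m"
  have m0: "1 \<le> m0" "m0 \<le> M" using r by (auto simp: m0_def M_def)
  have m: "1 \<le> m" "m \<le> m0" "m0 \<le> 2 * m" "2 * m \<le> m0 + 1" using m0 unfolding m_def by auto
  have d: "0 < d" "m + d = M + 1" "M \<le> 2 * d" using m m0 by (auto simp: d_def)
  have h0: "0 < h lam" using lam by (simp add: h_def)
  have M0: "0 < real M" using m0 by simp
  \<comment> \<open>The minimum keeps the relative entropy of order kl_const d m; the bound kl_const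
    \<le> 1/2 keeps c^2 \<ge> 1/2, so that (s c)^2 is comparable to s^2.\<close>
  define s c where "s = sqrt (kl_const * min 1 (M / (n * h lam)))" and "c = sqrt (1 - kl_const * min 1 (M / (n * h lam)))"
  have mn: "0 < min 1 (M / (n * h lam))" using M0 n h0 by simp
  have s2: "s\<^sup>2 = kl_const * min 1 (M / (n * h lam))" unfolding s_def using mn kl_const_bounds by simp
  have s2_pos: "0 < s\<^sup>2" unfolding s2 using mn kl_const_bounds by simp
  have s2_half: "s\<^sup>2 \<le> 1 / 2"
    unfolding s2 using mult_left_mono[of "min 1 (M / (n * h lam))" 1 kl_const] kl_const_bounds by linarith
  have c2: "c\<^sup>2 = 1 - s\<^sup>2" unfolding s2 c_def using s2_half unfolding s2 by simp
  have cs: "c\<^sup>2 + s\<^sup>2 = 1" by (simp add: c2)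
  have sc: "0 < (s * c)\<^sup>2" "s * c \<noteq> 0" using s2_pos s2_half c2 by (auto simp: power_mult_distrib)
  define \<kappa>' :: real where "\<kappa>' = ln 9"
  have \<kappa>': "0 < \<kappa>'" "exp (- \<kappa>') = 1 / 9" by (auto simp: \<kappa>'_def exp_minus)
  obtain N :: nat and U where N: "0 < N" and U: "\<And>w. w < N \<Longrightarrow> partial_isometry (k - r) r (U w)"
    and Um: "\<And>w. w < N \<Longrightarrow> (\<Sum>l<k - r. \<Sum>a<r. (U w l a)\<^sup>2) = real m"
    and sb: "\<And>T. (\<Sum>w<N. exp (- (\<kappa>' * d * (\<Sum>l<k - r. \<Sum>a<r. (U w l a - T l a)\<^sup>2)))) \<le> N * ((1 + exp (- \<kappa>')) / 2) ^ (d * m)"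
    using ex_partial_isometry_family[of d \<kappa>' m r "k - r"] d m \<kappa>' unfolding M_def m0_def by auto
  define V where "V w = rotated_frame k r s c (U w)" for w
  define V0 where "V0 = rotated_frame k r 0 1 (U 0)"
  \<comment> \<open>At s = 0 and c = 1 the frame does not depend on the partial isometry, so all
    frames share one reference law.\<close>
  have V0_eq: "rotated_frame k r 0 1 u = V0" for u
    unfolding V0_def by (intro ext) (simp add: rotated_frame_def)
  have VS: "V w \<in> stiefel k r" if "w < N" for w
    unfolding V_def using r by (intro rotated_frame_stiefel U that cs) auto
  have V0S: "V0 \<in> stiefel k r"
    unfolding V0_def using r N by (intro rotated_frame_stiefel U) auto
  define q where "q = d * m"
  have q: "1 \<le> q" using d m by (simp add: q_def)
  define t where "t = q * ln (4 / 3 :: real)"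
  have t: "0 < t" using q by (simp add: t_def)
  have et: "exp t = (4 / 3) ^ q" by (simp add: t_def exp_of_nat_mult)
  define K where "K = n * h lam / 2 * (s\<^sup>2 * m)"
  have K0: "0 \<le> K" using h0 by (simp add: K_def)
  \<comment> \<open>With these scalings \<beta> times the block loss is the exponent \<kappa>' d |U
    - T|^2 of the family bound, and \<beta> \<eta> = q ln (27/25).\<close>
  define \<beta> where "\<beta> = \<kappa>' * d / (s * c)\<^sup>2"
  define \<eta> where "\<eta> = ball_const * m * (s * c)\<^sup>2"
  have \<eta>: "0 < \<eta>" using ball_const_pos m sc by (simp add: \<eta>_def)
  have ball: "(\<Sum>w<N. exp (\<beta> * (\<eta> - frob_loss k r W (V w)))) \<le> N * (3 / 5) ^ q" for W
  proof -
    \<comment> \<open>The block of the estimated projection, rescaled so that it is compared with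
      \<open>U\<close> itself.\<close>
    define T where "T l a = proj k r W (r + l) a / (s * c)" for l a
    have \<beta>\<eta>: "exp (\<beta> * \<eta>) = (27 / 25) ^ q"
    proof -
      have "\<beta> * \<eta> = q * ln (27 / 25)"
        using sc \<kappa>' by (simp add: \<beta>_def \<eta>_def q_def ball_const_def \<kappa>'_def)
      then show ?thesis by (simp add: exp_of_nat_mult)
    qed
    have "exp (\<beta> * (\<eta> - frob_loss k r W (V w))) \<le> (27 / 25) ^ q * exp (- (\<kappa>' * d * (\<Sum>l<k - r. \<Sum>a<r. (U w l a - T l a)\<^sup>2)))" if w: "w < N" for w
    proof -
      have "(s * c)\<^sup>2 * (\<Sum>l<k - r. \<Sum>a<r. (U w l a - T l a)\<^sup>2) = (\<Sum>l<k - r. \<Sum>a<r. (proj k r W (r + l) a - s * c * U w l a)\<^sup>2)"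
        unfolding sum_distrib_left T_def
      proof (intro sum.cong refl)
        fix l a
        have "s * c * (U w l a - proj k r W (r + l) a / (s * c)) = s * c * U w l a - proj k r W (r + l) a"
          using sc by (simp add: field_simps)
        then show "(s * c)\<^sup>2 * (U w l a - proj k r W (r + l) a / (s * c))\<^sup>2 = (proj k r W (r + l) a - s * c * U w l a)\<^sup>2"
          by (metis power_mult_distrib power2_commute)
      qed
      also have "\<dots> \<le> frob_loss k r W (V w)"
        unfolding V_def using r by (intro frob_loss_rotated_frame U w) auto
      finally have "\<beta> * ((s * c)\<^sup>2 * (\<Sum>l<k - r. \<Sum>a<r. (U w l a - T l a)\<^sup>2)) \<le> \<beta> * frob_loss k r W (V w)"
        using \<kappa>' by (intro mult_left_mono) (auto simp: \<beta>_def)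
      also have "\<beta> * ((s * c)\<^sup>2 * (\<Sum>l<k - r. \<Sum>a<r. (U w l a - T l a)\<^sup>2)) = \<kappa>' * d * (\<Sum>l<k - r. \<Sum>a<r. (U w l a - T l a)\<^sup>2)"
        using sc by (simp add: \<beta>_def)
      finally have "exp (\<beta> * (\<eta> - frob_loss k r W (V w))) \<le> exp (\<beta> * \<eta> + - (\<kappa>' * d * (\<Sum>l<k - r. \<Sum>a<r. (U w l a - T l a)\<^sup>2)))"
        by (simp add: right_diff_distrib)
      then show ?thesis unfolding exp_add \<beta>\<eta> .
    qed
    then have "(\<Sum>w<N. exp (\<beta> * (\<eta> - frob_loss k r W (V w)))) \<le> (\<Sum>w<N. (27 / 25) ^ q * exp (- (\<kappa>' * d * (\<Sum>l<k - r. \<Sum>a<r. (U w l a - T l a)\<^sup>2))))"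
      by (intro sum_mono) auto
    also have "\<dots> \<le> (27 / 25) ^ q * (N * ((1 + exp (- \<kappa>')) / 2) ^ (d * m))"
      unfolding sum_distrib_left[symmetric] by (intro mult_left_mono sb) auto
    also have "\<dots> = N * ((27 / 25) * (5 / 9)) ^ q"
      unfolding \<kappa>' q_def[symmetric] power_mult_distrib by simp
    finally show ?thesis by simp
  qed
  have err: "exp t * (3 / 5) ^ q + K / (t - 1 + exp (- t)) \<le> 9 / 10"
  proof -
    have "exp t * (3 / 5) ^ q = (4 / 5) ^ q" unfolding et by (simp flip: power_mult_distrib)
    also have "\<dots> \<le> (4 / 5) ^ 1" using q by (intro power_decreasing) auto
    finally have e1: "exp t * (3 / 5) ^ q \<le> 4 / 5" by simp
    \<comment> \<open>Here exp (- t) = (3/4)^q, so Bernoulli's inequality bounds t - 1 + exp (- t)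
      below linearly in \<open>q\<close>.\<close>
    have "1 + real q * (- 1 / 4) \<le> (1 + - 1 / 4) ^ q" by (rule Bernoulli_inequality) simp
    also have "(1 + - 1 / 4) ^ q = exp (- t)" unfolding exp_minus et by (simp add: power_divide)
    finally have "1 + real q * (- 1 / 4) \<le> exp (- t)" .
    moreover have "q * (10 * kl_const) = t - real q / 4"
      by (simp add: t_def kl_const_def right_diff_distrib)
    ultimately have gt: "q * (10 * kl_const) \<le> t - 1 + exp (- t)" by simp
    \<comment> \<open>With M \<le> 2 d this gives K \<le> kl_const q, one tenth of the linear lower
      bound; the two error terms are then at most 4/5 and 1/10.\<close>
    have "n * h lam * s\<^sup>2 \<le> M * kl_const"
    proof -
      have "n * h lam * min 1 (M / (n * h lam)) \<le> n * h lam * (M / (n * h lam))"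
        using h0 by (intro mult_left_mono) auto
      also have "\<dots> = M" using h0 n by simp
      finally have "n * h lam * min 1 (M / (n * h lam)) * kl_const \<le> M * kl_const"
        using kl_const_bounds by (intro mult_right_mono) auto
      then show ?thesis by (simp add: s2 mult_ac)
    qed
    also have "\<dots> \<le> 2 * d * kl_const" using d kl_const_bounds by (intro mult_right_mono) auto
    finally have "n * h lam * s\<^sup>2 * (m / 2) \<le> 2 * d * kl_const * (m / 2)" by (intro mult_right_mono) auto
    then have "K \<le> q * kl_const" by (simp add: K_def q_def mult_ac)
    also have "\<dots> \<le> (t - 1 + exp (- t)) / 10" using gt by simp
    finally have "K / (t - 1 + exp (- t)) \<le> 1 / 10"
      using exp_remainder_pos[OF t] by (simp add: field_simps)
    then show ?thesis using e1 by simp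
  qed
  have "\<exists>w<N. ennreal (\<eta> / 10) \<le> risk n k r Vh (V w) (\<lambda>_. lam)"
  proof (rule ex_risk_ge[OF Vh lam N VS V0S t _ K0 _ \<eta> ball err])
    show "spiked_KL n k r lam (V w) V0 \<le> K" if "w < N" for w
      using spiked_KL_rotated_frame[OF U[OF that] cs, of n lam] r that
      unfolding V_def V0_eq K_def by (simp add: Um)
  qed (use \<kappa>' in \<open>auto simp: \<beta>_def\<close>)
  then obtain w where w: "w < N" "ennreal (\<eta> / 10) \<le> risk n k r Vh (V w) (\<lambda>_. lam)" by blast
  \<comment> \<open>All spikes equal \<open>lam\<close>, so these models lie in the class for every
    \<kappa> > 1, and the constant does not depend on \<kappa>.\<close>
  have "(V w, \<lambda>_. lam) \<in> Theta0 \<kappa> k r lam"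
    using VS[OF w(1)] lam \<kappa> by (simp add: Theta0_def)
  then have sup: "risk n k r Vh (V w) (\<lambda>_. lam) \<le> (SUP p \<in> Theta0 \<kappa> k r lam. risk n k r Vh (fst p) (snd p))"
    by (rule SUP_upper2) simp
  \<comment> \<open>The factor 40 collects m \<ge> m0 / 2, c^2 \<ge> 1/2 and the miss probability
    1/10.\<close>
  have "ball_const * kl_const / 40 * (m0 * min 1 (M / (n * h lam))) = ball_const * (m0 / 2) * (s\<^sup>2 * (1 / 2)) / 10"
    by (simp add: s2)
  also have "\<dots> \<le> ball_const * m * (s\<^sup>2 * c\<^sup>2) / 10"
    using m ball_const_pos s2_half c2 by (intro divide_right_mono mult_mono) auto
  also have "\<dots> = \<eta> / 10" by (simp add: \<eta>_def power_mult_distrib)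
  finally have "ball_const * kl_const / 40 * (m0 * min 1 (M / (n * h lam))) \<le> \<eta> / 10" .
  then show ?thesis
    unfolding m0_def[symmetric] M_def[symmetric] using w(2) sup by (meson ennreal_leI order_trans)
qed

theorem theorem8:
  shows "\<exists>c>0. \<forall>(\<kappa>::real) (k::nat) (r::nat) (n::nat) (lam::real).
           1 < \<kappa> \<and> 1 \<le> r \<and> r \<le> k \<and> 1 \<le> n \<and> 0 < lam \<longrightarrow>
           (INF Vh \<in> estimators n k r. SUP p \<in> Theta0 \<kappa> k r lam. risk n k r Vh (fst p) (snd p))
             \<ge> ennreal (c * min (real r) (min (real (k - r))
                   (real r * real (k - r) / (real n * h lam))))"
proof (intro exI conjI allI impI)
  show "0 < ball_const * kl_const / 40" using ball_const_pos kl_const_bounds by simp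
  fix \<kappa> lam :: real and k r n :: nat
  assume A: "1 < \<kappa> \<and> 1 \<le> r \<and> r \<le> k \<and> 1 \<le> n \<and> 0 < lam"
  let ?c = "ball_const * kl_const / 40"
  let ?X = "real r * real (k - r) / (real n * h lam)"
  show "ennreal (?c * min (real r) (min (real (k - r)) ?X))
     \<le> (INF Vh \<in> estimators n k r. SUP p \<in> Theta0 \<kappa> k r lam. risk n k r Vh (fst p) (snd p))"
  proof (cases "r = k")
    \<comment> \<open>For r = k the claimed lower bound is zero.\<close>
    case True
    then show ?thesis by simp
  next
    case False
    \<comment> \<open>A product of two numbers is their minimum times their maximum, so the minimum
      factors out of all three terms.\<close>
    have "real r * real (k - r) = real (min r (k - r)) * real (max r (k - r))"
      by (cases "r \<le> k - r") (auto simp: min_def max_def)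
    then have eq: "min (real r) (min (real (k - r)) ?X)
      = real (min r (k - r)) * min 1 (real (max r (k - r)) / (real n * h lam))"
      by (simp add: min_mult_distrib_left of_nat_min min.assoc)
    show ?thesis
      unfolding eq
      by (intro INF_greatest sup_risk_ge) (use A False in auto)
  qed
qed

end
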